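(* Let $g$ be a smooth pseudo-Riemannian metric on an open set $U$ (covered by a single coordinate chart), let $\mathfrak{M}$ denote the space of smooth pseudo-Riemannian metrics on $U$, and let $p\in U$. Suppose $\{\varphi_\tau\}_{\tau\in\mathbb{R}}$ is a one-parameter family of diffeomorphisms with $\varphi_\tau(p)=p$ for all $\tau$ and such that $\lim_{\tau\to\infty}\varphi_\tau^*g=g_0\in\mathfrak{M}$. Then every polynomial curvature invariant of $g$ evaluated at $p$ equals the corresponding polynomial curvature invariant of $g_0$ evaluated at $p$.
   Context: A polynomial curvature invariant of a metric is a scalar obtained as a polynomial in full contractions (using the metric) of the Riemann curvature tensor and its covariant derivatives of arbitrary order (e.g. the Ricci scalar, $R_{\mu\nu\alpha\beta}R^{\mu\nu\alpha\beta}$). The limit $\lim_{\tau\to\infty}\varphi_\tau^*g=g_0$ is understood in the given coordinates on $U$: the components of $\varphi_\tau^*g$ and their partial derivatives converge to those of the smooth metric $g_0$. *)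

theory Defs
  imports "HOL-Analysis.Analysis"
begin

text \<open>Coordinates: the chart domain U is an open subset of real^'n, 'n a finite index type.
A (covariant) tensor field is given by its components: real^'n => 'n list => real.\<close>

definition pd :: "'n::finite \<Rightarrow> (real^'n \<Rightarrow> real) \<Rightarrow> real^'n \<Rightarrow> real" where
  "pd i f x = deriv (\<lambda>t. f (x + t *\<^sub>R axis i 1)) 0"

fun pds :: "'n::finite list \<Rightarrow> (real^'n \<Rightarrow> real) \<Rightarrow> real^'n \<Rightarrow> real" where
  "pds [] f = f"
| "pds (i # is) f = pd i (pds is f)"

definition smooth_on :: "(real^'n::finite) set \<Rightarrow> (real^'n \<Rightarrow> real) \<Rightarrow> bool" where
  "smooth_on U f \<longleftrightarrow> (\<forall>is. \<forall>x\<in>U. pds is f differentiable (at x))"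

definition pseudo_riem_metric :: "(real^'n::finite) set \<Rightarrow> (real^'n \<Rightarrow> real^'n^'n) \<Rightarrow> bool" where
  "pseudo_riem_metric U g \<longleftrightarrow>
     (\<forall>x\<in>U. transpose (g x) = g x \<and> invertible (g x)) \<and>
     (\<forall>i j. smooth_on U (\<lambda>x. g x $ i $ j))"

definition diffeo_on :: "(real^'n::finite) set \<Rightarrow> (real^'n \<Rightarrow> real^'n) \<Rightarrow> bool" where
  "diffeo_on U \<phi> \<longleftrightarrow> bij_betw \<phi> U U \<and>
     (\<forall>k. smooth_on U (\<lambda>x. \<phi> x $ k)) \<and>
     (\<forall>k. smooth_on U (\<lambda>x. inv_into U \<phi> x $ k))"

definition pullback :: "(real^'n::finite \<Rightarrow> real^'n) \<Rightarrow> (real^'n \<Rightarrow> real^'n^'n) \<Rightarrow> real^'n \<Rightarrow> real^'n^'n" where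
  "pullback \<phi> g x = (\<chi> i j. \<Sum>k\<in>UNIV. \<Sum>l\<in>UNIV.
      pd i (\<lambda>y. \<phi> y $ k) x * pd j (\<lambda>y. \<phi> y $ l) x * g (\<phi> x) $ k $ l)"

definition christoffel :: "(real^'n::finite \<Rightarrow> real^'n^'n) \<Rightarrow> real^'n \<Rightarrow> 'n \<Rightarrow> 'n \<Rightarrow> 'n \<Rightarrow> real" where
  "christoffel g x k i j = (1/2) * (\<Sum>l\<in>UNIV. matrix_inv (g x) $ k $ l *
      (pd i (\<lambda>y. g y $ j $ l) x + pd j (\<lambda>y. g y $ i $ l) x - pd l (\<lambda>y. g y $ i $ j) x))"

definition riem_up :: "(real^'n::finite \<Rightarrow> real^'n^'n) \<Rightarrow> real^'n \<Rightarrow> 'n \<Rightarrow> 'n \<Rightarrow> 'n \<Rightarrow> 'n \<Rightarrow> real" where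
  "riem_up g x a b c d =
     pd c (\<lambda>y. christoffel g y a d b) x - pd d (\<lambda>y. christoffel g y a c b) x
     + (\<Sum>e\<in>UNIV. christoffel g x a c e * christoffel g x e d b
                   - christoffel g x a d e * christoffel g x e c b)"

definition riem :: "(real^'n::finite \<Rightarrow> real^'n^'n) \<Rightarrow> real^'n \<Rightarrow> 'n list \<Rightarrow> real" where
  "riem g x is = (\<Sum>e\<in>UNIV. g x $ (is!0) $ e * riem_up g x e (is!1) (is!2) (is!3))"

definition nabla :: "(real^'n::finite \<Rightarrow> real^'n^'n) \<Rightarrow> (real^'n \<Rightarrow> 'n list \<Rightarrow> real) \<Rightarrow> real^'n \<Rightarrow> 'n list \<Rightarrow> real" where
  "nabla g T x is = (let i = hd is; js = tl is in
     pd i (\<lambda>y. T y js) x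
     - (\<Sum>r<length js. \<Sum>l\<in>UNIV. christoffel g x l i (js!r) * T x (js[r := l])))"

fun covR :: "(real^'n::finite \<Rightarrow> real^'n^'n) \<Rightarrow> nat \<Rightarrow> real^'n \<Rightarrow> 'n list \<Rightarrow> real" where
  "covR g 0 = riem g"
| "covR g (Suc m) = nabla g (covR g m)"

fun prodT :: "(real^'n::finite \<Rightarrow> real^'n^'n) \<Rightarrow> nat list \<Rightarrow> real^'n \<Rightarrow> 'n list \<Rightarrow> real" where
  "prodT g [] x is = 1"
| "prodT g (m # ms) x is = covR g m x (take (m+4) is) * prodT g ms x (drop (m+4) is)"

definition total_rank :: "nat list \<Rightarrow> nat" where
  "total_rank ms = sum_list (map (\<lambda>m. m + 4) ms)"

definition valid_pairing :: "nat \<Rightarrow> (nat \<Rightarrow> nat) \<Rightarrow> bool" where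
  "valid_pairing N \<sigma> \<longleftrightarrow> (\<forall>a<N. \<sigma> a < N \<and> \<sigma> a \<noteq> a \<and> \<sigma> (\<sigma> a) = a)"

definition full_contraction :: "(real^'n::finite \<Rightarrow> real^'n^'n) \<Rightarrow> nat list \<Rightarrow> (nat \<Rightarrow> nat) \<Rightarrow> real^'n \<Rightarrow> real" where
  "full_contraction g ms \<sigma> x =
     (\<Sum>is\<in>{is :: 'n list. length is = total_rank ms}.
        prodT g ms x is *
        (\<Prod>a\<in>{a. a < total_rank ms \<and> a < \<sigma> a}. matrix_inv (g x) $ (is!a) $ (is!(\<sigma> a))))"

text \<open>A polynomial curvature invariant: a real polynomial in full contractions, given as a list of
 monomials (coefficient, list of contraction data).\<close>
type_synonym curv_poly = "(real \<times> (nat list \<times> (nat \<Rightarrow> nat)) list) list"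

definition valid_curv_poly :: "curv_poly \<Rightarrow> bool" where
  "valid_curv_poly P \<longleftrightarrow> (\<forall>(c, mon)\<in>set P. \<forall>(ms, \<sigma>)\<in>set mon. valid_pairing (total_rank ms) \<sigma>)"

definition curv_inv :: "curv_poly \<Rightarrow> (real^'n::finite \<Rightarrow> real^'n^'n) \<Rightarrow> real^'n \<Rightarrow> real" where
  "curv_inv P g x = sum_list (map (\<lambda>(c, mon). c * prod_list (map (\<lambda>(ms, \<sigma>). full_contraction g ms \<sigma> x) mon)) P)"

end

theory Submission
  imports Defs
begin

text \<open>
  Every curvature invariant at \<open>p\<close> is a continuous function of the jet of the metric at \<open>p\<close>, so its values
  on the metrics \<open>\<phi>\<^sub>\<tau>\<^sup>*g\<close> converge to its value on \<open>g\<^sub>0\<close>. By diffeomorphism invariance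
  and \<open>\<phi>\<^sub>\<tau> p = p\<close> the value on \<open>\<phi>\<^sub>\<tau>\<^sup>*g\<close> at \<open>p\<close> does not depend on \<open>\<tau>\<close>: it is the value on \<open>g\<close>.
  For the invariance, write \<open>J\<close> for the Jacobian matrix of \<open>\<phi>\<close> and \<open>A\<^sub>c\<close>, \<open>B\<^sub>c\<close> for the connection matrices of
  \<open>\<phi>\<^sup>*g\<close> and for those of \<open>g\<close> pulled back as one-forms. The transformation law of the Christoffel symbols is the
  gauge transformation \<open>J A\<^sub>c = \<partial>\<^sub>cJ + B\<^sub>c J\<close>, from which the tensoriality of the curvature and
  of its covariant derivatives follows without inverting \<open>J\<close>.
\<close>

subsection \<open>Partial derivatives\<close>

lemma pd_eqI:
  assumes "(f has_derivative D) (at x)"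
  shows "pd i f x = D (axis i 1)"
proof -
  have "((\<lambda>t. f (x + t *\<^sub>R axis i 1)) has_derivative (\<lambda>t. D (t *\<^sub>R axis i 1))) (at 0)"
  proof (rule has_derivative_compose[where g = f and f = "\<lambda>t. x + t *\<^sub>R axis i 1"])
    show "((\<lambda>t. x + t *\<^sub>R axis i 1) has_derivative (\<lambda>t. t *\<^sub>R axis i 1)) (at 0)"
      by (auto intro!: derivative_eq_intros)
    show "(f has_derivative D) (at (x + 0 *\<^sub>R axis i 1))" using assms by simp
  qed
  moreover have "D (t *\<^sub>R axis i 1) = t * D (axis i 1)" for t
    using has_derivative_linear[OF assms] by (simp add: linear_cmul)
  ultimately have "((\<lambda>t. f (x + t *\<^sub>R axis i 1)) has_real_derivative D (axis i 1)) (at 0)"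
    by (simp add: has_field_derivative_def mult_commute_abs)
  then show ?thesis unfolding pd_def by (rule DERIV_imp_deriv)
qed

text \<open>Together with \<open>pd_eqI\<close> this transfers the rules for total derivatives to
  partial ones, by evaluating them at a basis vector. The formula comes from expanding
  \<open>v\<close> in the standard basis and using linearity of the derivative.\<close>

lemma has_derivative_pd:
  assumes "f differentiable (at x)"
  shows "(f has_derivative (\<lambda>v. \<Sum>i\<in>UNIV. v $ i * pd i f x)) (at x)"
proof -
  obtain D where D: "(f has_derivative D) (at x)"
    using assms unfolding differentiable_def by blast
  have "D v = (\<Sum>i\<in>UNIV. v $ i * pd i f x)" for v
  proof -
    have "D v = D (\<Sum>i\<in>UNIV. v $ i *\<^sub>R axis i 1)"
      by (simp add: basis_expansion flip: scalar_mult_eq_scaleR)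
    also have "\<dots> = (\<Sum>i\<in>UNIV. v $ i * D (axis i 1))"
      using has_derivative_linear[OF D] by (simp add: linear_sum linear_cmul)
    finally show ?thesis by (simp add: pd_eqI[OF D])
  qed
  then have "D = (\<lambda>v. \<Sum>i\<in>UNIV. v $ i * pd i f x)" by blast
  then show ?thesis using D by simp
qed

text \<open>\<open>pd\<close> differentiates at parameter 0 only; the mean value theorem along a
  segment needs the derivative at each parameter \<open>t\<close>.\<close>

lemma has_real_derivative_pd_line:
  assumes "f differentiable (at (x + t *\<^sub>R axis i 1))"
  shows "((\<lambda>s. f (x + s *\<^sub>R axis i 1)) has_real_derivative pd i f (x + t *\<^sub>R axis i 1)) (at t)"
proof -
  obtain D where D: "(f has_derivative D) (at (x + t *\<^sub>R axis i 1))"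
    using assms unfolding differentiable_def by blast
  have "((\<lambda>s. f (x + s *\<^sub>R axis i 1)) has_derivative (\<lambda>s. D (s *\<^sub>R axis i 1))) (at t)"
    by (rule has_derivative_compose[where g = f and g' = D and f = "\<lambda>s. x + s *\<^sub>R axis i 1"])
       (auto intro!: derivative_eq_intros D)
  moreover have "D (s *\<^sub>R axis i 1) = s * D (axis i 1)" for s
    using has_derivative_linear[OF D] by (simp add: linear_cmul)
  ultimately show ?thesis
    by (simp add: has_field_derivative_def mult_commute_abs pd_eqI[OF D])
qed

lemma pd_const: "pd i (\<lambda>y. c) x = 0"
  by (rule pd_eqI[OF has_derivative_const])

lemma pd_add:
  assumes "f differentiable (at x)" "g differentiable (at x)"
  shows "pd i (\<lambda>y. f y + g y) x = pd i f x + pd i g x"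
  using pd_eqI[OF has_derivative_add[OF assms[THEN has_derivative_pd]], of i]
    pd_eqI[OF has_derivative_pd[OF assms(1)], of i] pd_eqI[OF has_derivative_pd[OF assms(2)], of i]
  by simp

lemma pd_mult:
  assumes "f differentiable (at x)" "g differentiable (at x)"
  shows "pd i (\<lambda>y. f y * g y) x = pd i f x * g x + f x * pd i g x"
  using pd_eqI[OF has_derivative_mult[OF assms[THEN has_derivative_pd]], of i]
    pd_eqI[OF has_derivative_pd[OF assms(1)], of i] pd_eqI[OF has_derivative_pd[OF assms(2)], of i]
  by simp

lemma pd_sum:
  assumes "finite S" "\<And>s. s \<in> S \<Longrightarrow> f s differentiable (at x)"
  shows "pd i (\<lambda>y. \<Sum>s\<in>S. f s y) x = (\<Sum>s\<in>S. pd i (f s) x)"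
  using assms
proof (induction S rule: finite_induct)
  case (insert a S)
  then have "(\<lambda>y. \<Sum>s\<in>S. f s y) differentiable (at x)"
    by (intro differentiable_sum) auto
  with insert show ?case by (simp add: pd_add)
qed (simp add: pd_const)

lemma pd_inverse:
  assumes "f differentiable (at x)" "f x \<noteq> 0"
  shows "pd i (\<lambda>y. inverse (f y)) x = - (pd i f x * (inverse (f x) * inverse (f x)))"
  using pd_eqI[OF Deriv.has_derivative_inverse[OF assms(2) has_derivative_pd[OF assms(1)]], of i]
    pd_eqI[OF has_derivative_pd[OF assms(1)], of i]
  by (simp add: mult_ac)

section \<open>The chain rule and the locality of partial derivatives\<close>

lemma differentiable_vec:
  fixes \<phi> :: "real^'n \<Rightarrow> real^'m"
  assumes "\<And>k. (\<lambda>y. \<phi> y $ k) differentiable (at x)"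
  shows "\<phi> differentiable (at x)"
  using assms by (subst differentiable_componentwise_within) (auto simp: Basis_vec_def inner_axis)

lemma pd_compose:
  fixes \<phi> :: "real^'n \<Rightarrow> real^'m"
  assumes f: "f differentiable (at (\<phi> x))" and \<phi>: "\<And>k. (\<lambda>y. \<phi> y $ k) differentiable (at x)"
  shows "pd i (\<lambda>y. f (\<phi> y)) x = (\<Sum>k\<in>UNIV. pd i (\<lambda>y. \<phi> y $ k) x * pd k f (\<phi> x))"
proof -
  obtain D where D: "(\<phi> has_derivative D) (at x)"
    using differentiable_vec[OF \<phi>] unfolding differentiable_def by blast
  have "pd i (\<lambda>y. \<phi> y $ k) x = D (axis i 1) $ k" for k
    by (rule pd_eqI[OF bounded_linear.has_derivative[OF bounded_linear_vec_nth D]])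
  moreover have "pd i (\<lambda>y. f (\<phi> y)) x = (\<Sum>k\<in>UNIV. D (axis i 1) $ k * pd k f (\<phi> x))"
    by (rule pd_eqI[OF has_derivative_compose[OF D has_derivative_pd[OF f]]])
  ultimately show ?thesis by simp
qed

lemma differentiable_cong_open:
  assumes "open U" "x \<in> U" "\<And>y. y \<in> U \<Longrightarrow> f y = g y"
  shows "f differentiable (at x) \<longleftrightarrow> g differentiable (at x)"
proof -
  obtain d where d: "d > 0" "ball x d \<subseteq> U" using assms open_contains_ball by blast
  then have "f y = g y" if "dist y x < d" for y
    using that assms(3) by (auto simp: dist_commute)
  then show ?thesis using d(1) differentiable_transform_within[of _ x UNIV d] by (metis UNIV_I)
qed

lemma pd_cong_open:
  assumes "open U" "x \<in> U" "\<And>y. y \<in> U \<Longrightarrow> f y = g y"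
  shows "pd i f x = pd i g x"
proof -
  have "((\<lambda>t. x + t *\<^sub>R axis i 1) \<longlongrightarrow> x + 0 *\<^sub>R axis i 1) (nhds (0::real))"
    by (intro tendsto_intros filterlim_ident)
  then have "eventually (\<lambda>t. x + t *\<^sub>R axis i 1 \<in> U) (nhds (0::real))"
    using assms(1,2) by (auto dest: topological_tendstoD)
  then have "eventually (\<lambda>t. f (x + t *\<^sub>R axis i 1) = g (x + t *\<^sub>R axis i 1)) (nhds (0::real))"
    by eventually_elim (use assms in auto)
  then show ?thesis unfolding pd_def by (rule deriv_cong_ev) simp
qed

lemma pds_append: "pds (is @ js) f = pds is (pds js f)"
  by (induction "is") auto

lemma pds_cong_open:
  assumes "open U" "\<And>y. y \<in> U \<Longrightarrow> f y = g y" "x \<in> U"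
  shows "pds is f x = pds is g x"
  using assms(3)
proof (induction "is" arbitrary: x)
  case (Cons i "is")
  then show ?case unfolding pds.simps by (intro pd_cong_open[OF assms(1)])
qed (use assms in auto)

text \<open>The left-hand side is symmetric in \<open>i\<close> and \<open>j\<close>, which yields the symmetry of second derivatives.\<close>

lemma mixed_difference_mean_value:
  fixes f :: "real^'n \<Rightarrow> real"
  assumes f: "\<And>y. y \<in> ball x d \<Longrightarrow> f differentiable (at y)"
    and fi: "\<And>y. y \<in> ball x d \<Longrightarrow> pd i f differentiable (at y)"
    and h: "0 < h" "2 * h < d"
  shows "\<exists>y\<in>ball x d. f (x + h *\<^sub>R axis i 1 + h *\<^sub>R axis j 1) - f (x + h *\<^sub>R axis i 1)
     - f (x + h *\<^sub>R axis j 1) + f x = h * (h * pd j (pd i f) y)"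
proof -
  \<comment> \<open>The bound \<open>2 * h < d\<close> keeps every point reached by the two
    displacements inside the ball.\<close>
  have inball: "x + s *\<^sub>R axis i 1 + t *\<^sub>R axis j 1 \<in> ball x d" if "0 \<le> s" "s \<le> h" "0 \<le> t" "t \<le> h" for s t
  proof -
    have "norm (s *\<^sub>R axis i 1 + t *\<^sub>R axis j (1::real)) \<le> s + t"
      using norm_triangle_ineq[of "s *\<^sub>R axis i 1" "t *\<^sub>R axis j (1::real)"] that by simp
    also have "\<dots> < d" using h that by simp
    finally have "norm (s *\<^sub>R axis i 1 + t *\<^sub>R axis j (1::real)) < d" .
    moreover have "x + v \<in> ball x d" if "norm v < d" for v
      using that by (simp add: dist_norm)
    ultimately show ?thesis unfolding add.assoc by blast
  qed
  have inball0: "x + s *\<^sub>R axis i 1 \<in> ball x d" if "0 \<le> s" "s \<le> h" for s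
    using inball[of s 0] that h by simp
  \<comment> \<open>\<open>F s\<close> is the increment of \<open>f\<close> in direction
    \<open>j\<close>. The mean value theorem in direction \<open>i\<close> turns the increment of
    \<open>F\<close> into an increment of \<open>pd i f\<close> in direction \<open>j\<close>, and a
    second application yields the iterated derivative.\<close>
  define F where "F s = f (x + h *\<^sub>R axis j 1 + s *\<^sub>R axis i 1) - f (x + s *\<^sub>R axis i 1)" for s
  have inball': "x + h *\<^sub>R axis j 1 + s *\<^sub>R axis i 1 \<in> ball x d" if "0 \<le> s" "s \<le> h" for s
    using inball[of s h] that h by (simp add: algebra_simps)
  have "(F has_real_derivative pd i f (x + h *\<^sub>R axis j 1 + s *\<^sub>R axis i 1) - pd i f (x + s *\<^sub>R axis i 1)) (at s)"
    if "0 \<le> s" "s \<le> h" for s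
    unfolding F_def by (intro DERIV_diff has_real_derivative_pd_line f inball0 inball' that)
  from MVT2[OF h(1), of F, OF this] obtain s where s: "0 < s" "s < h"
    "F h - F 0 = h * (pd i f (x + h *\<^sub>R axis j 1 + s *\<^sub>R axis i 1) - pd i f (x + s *\<^sub>R axis i 1))"
    by auto
  have "((\<lambda>t. pd i f (x + s *\<^sub>R axis i 1 + t *\<^sub>R axis j 1)) has_real_derivative
      pd j (pd i f) (x + s *\<^sub>R axis i 1 + t *\<^sub>R axis j 1)) (at t)" if "0 \<le> t" "t \<le> h" for t
    by (intro has_real_derivative_pd_line fi inball) (use s that in auto)
  from MVT2[OF h(1), of "\<lambda>t. pd i f (x + s *\<^sub>R axis i 1 + t *\<^sub>R axis j 1)", OF this] obtain t where t: "0 < t" "t < h"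
    "pd i f (x + s *\<^sub>R axis i 1 + h *\<^sub>R axis j 1) - pd i f (x + s *\<^sub>R axis i 1)
      = h * pd j (pd i f) (x + s *\<^sub>R axis i 1 + t *\<^sub>R axis j 1)"
    by auto
  show ?thesis
  proof (rule bexI)
    show "x + s *\<^sub>R axis i 1 + t *\<^sub>R axis j 1 \<in> ball x d"
      using s t by (intro inball) auto
    show "f (x + h *\<^sub>R axis i 1 + h *\<^sub>R axis j 1) - f (x + h *\<^sub>R axis i 1)
     - f (x + h *\<^sub>R axis j 1) + f x = h * (h * pd j (pd i f) (x + s *\<^sub>R axis i 1 + t *\<^sub>R axis j 1))"
      using s(3) t(3) by (simp add: F_def add_ac)
  qed
qed

text \<open>The mixed difference divided by the square of \<open>h\<close> is a value, at some point
  near \<open>x\<close>, of each of the two iterated derivatives. Continuity at \<open>x\<close>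
  then forces these to agree there.\<close>

lemma pd_commute:
  fixes f :: "real^'n \<Rightarrow> real"
  assumes U: "open U" "x \<in> U"
    and f: "\<And>y. y \<in> U \<Longrightarrow> f differentiable (at y)"
    and fi: "\<And>y. y \<in> U \<Longrightarrow> pd i f differentiable (at y)"
    and fj: "\<And>y. y \<in> U \<Longrightarrow> pd j f differentiable (at y)"
    and c: "isCont (pd i (pd j f)) x" "isCont (pd j (pd i f)) x"
  shows "pd i (pd j f) x = pd j (pd i f) x"
proof (rule ccontr)
  assume ne: "pd i (pd j f) x \<noteq> pd j (pd i f) x"
  \<comment> \<open>Half the gap: two values lying within \<open>e\<close> of the two different
    numbers cannot coincide.\<close>
  define e where "e = \<bar>pd i (pd j f) x - pd j (pd i f) x\<bar> / 2"
  have e: "e > 0" using ne by (simp add: e_def)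
  obtain d1 where d1: "d1 > 0" "ball x d1 \<subseteq> U" using U open_contains_ball by blast
  obtain d2 where d2: "d2 > 0" "\<And>y. dist y x < d2 \<Longrightarrow> \<bar>pd i (pd j f) y - pd i (pd j f) x\<bar> < e"
    using c(1) e unfolding continuous_at_eps_delta dist_real_def by blast
  obtain d3 where d3: "d3 > 0" "\<And>y. dist y x < d3 \<Longrightarrow> \<bar>pd j (pd i f) y - pd j (pd i f) x\<bar> < e"
    using c(2) e unfolding continuous_at_eps_delta dist_real_def by blast
  define d where "d = min d1 (min d2 d3)"
  have d: "d > 0" "ball x d \<subseteq> U" using d1 d2 d3 by (auto simp: d_def)
  define h where "h = d / 3"
  have h: "0 < h" "2 * h < d" using d by (auto simp: h_def)
  obtain y where y: "y \<in> ball x d" "f (x + h *\<^sub>R axis i 1 + h *\<^sub>R axis j 1) - f (x + h *\<^sub>R axis i 1)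
     - f (x + h *\<^sub>R axis j 1) + f x = h * (h * pd j (pd i f) y)"
    using mixed_difference_mean_value[of x d f i h j] f fi h d(2) by blast
  obtain z where z: "z \<in> ball x d" "f (x + h *\<^sub>R axis j 1 + h *\<^sub>R axis i 1) - f (x + h *\<^sub>R axis j 1)
     - f (x + h *\<^sub>R axis i 1) + f x = h * (h * pd i (pd j f) z)"
    using mixed_difference_mean_value[of x d f j h i] f fj h d(2) by blast
  have "h * (h * pd i (pd j f) z) = h * (h * pd j (pd i f) y)"
    unfolding y(2)[symmetric] z(2)[symmetric] by (simp add: add_ac)
  then have "pd i (pd j f) z = pd j (pd i f) y" using h by simp
  moreover have "\<bar>pd i (pd j f) z - pd i (pd j f) x\<bar> < e" "\<bar>pd j (pd i f) y - pd j (pd i f) x\<bar> < e"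
    using y z by (auto intro!: d2 d3 simp: d_def dist_commute)
  moreover have "\<bar>pd i (pd j f) x - pd j (pd i f) x\<bar> = 2 * e" by (simp add: e_def)
  ultimately show False by linarith
qed

subsection \<open>Convergent families of smooth functions\<close>

text \<open>A family of functions indexed by \<open>a\<close> whose members are differentiable to order \<open>n\<close> on \<open>U\<close>
  and whose partial derivatives up to that order converge along \<open>F\<close> to those of the member
  with index \<open>a0\<close>. With the filter \<open>bot\<close> the second condition is void and only smoothness remains.\<close>

locale jet_family =
  fixes U :: "(real^'n::finite) set" and F :: "'b filter" and a0 :: 'b
  assumes open_U: "open U"
begin

definition jets :: "nat \<Rightarrow> ('b \<Rightarrow> real^'n \<Rightarrow> real) \<Rightarrow> bool" where
  "jets n f \<longleftrightarrow> (\<forall>is. length is \<le> n \<longrightarrow> (\<forall>x\<in>U. (\<forall>a. pds is (f a) differentiable (at x)) \<and>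
     ((\<lambda>a. pds is (f a) x) \<longlongrightarrow> pds is (f a0) x) F))"

definition jet :: "('b \<Rightarrow> real^'n \<Rightarrow> real) \<Rightarrow> bool" where
  "jet f \<longleftrightarrow> (\<forall>n. jets n f)"

lemma jets_0:
  "jets 0 f \<longleftrightarrow> (\<forall>x\<in>U. (\<forall>a. f a differentiable (at x)) \<and> ((\<lambda>a. f a x) \<longlongrightarrow> f a0 x) F)"
  by (simp add: jets_def)

lemma jets_mono: "jets n f \<Longrightarrow> m \<le> n \<Longrightarrow> jets m f"
  unfolding jets_def by (meson le_trans)

text \<open>In \<open>pds\<close> the last index of the list acts first, so splitting off that index
  reduces the order by one and replaces \<open>f\<close> by \<open>pd i f\<close>. The closure rules
  below are inductions along this recursion.\<close>

lemma jets_Suc: "jets (Suc n) f \<longleftrightarrow> jets 0 f \<and> (\<forall>i. jets n (\<lambda>a. pd i (f a)))"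
proof safe
  assume f: "jets (Suc n) f"
  show "jets 0 f" by (rule jets_mono[OF f]) simp
  fix i
  show "jets n (\<lambda>a. pd i (f a))"
    unfolding jets_def
  proof (intro allI impI)
    fix "is" :: "'n list" assume "length is \<le> n"
    with f[unfolded jets_def, rule_format, of "is @ [i]"]
    show "\<forall>x\<in>U. (\<forall>a. pds is (pd i (f a)) differentiable at x) \<and>
             ((\<lambda>a. pds is (pd i (f a)) x) \<longlongrightarrow> pds is (pd i (f a0)) x) F"
      by (simp add: pds_append)
  qed
next
  assume f: "jets 0 f" "\<forall>i. jets n (\<lambda>a. pd i (f a))"
  show "jets (Suc n) f"
    unfolding jets_def
  proof (intro allI impI)
    fix "is" :: "'n list" assume l: "length is \<le> Suc n"
    show "\<forall>x\<in>U. (\<forall>a. pds is (f a) differentiable at x) \<and>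
             ((\<lambda>a. pds is (f a) x) \<longlongrightarrow> pds is (f a0) x) F"
    proof (cases "is" rule: rev_cases)
      case Nil
      then show ?thesis using f(1) by (simp add: jets_0)
    next
      case (snoc js i)
      then show ?thesis using f(2)[rule_format, of i] l unfolding jets_def
        by (simp add: pds_append)
    qed
  qed
qed

lemma jets_cong:
  assumes "\<And>a x. x \<in> U \<Longrightarrow> f a x = g a x"
  shows "jets n f \<longleftrightarrow> jets n g"
proof -
  have eq: "pds is (f a) x = pds is (g a) x" if "x \<in> U" for "is" a x
    by (rule pds_cong_open[OF open_U assms that])
  have "pds is (f a) differentiable (at x) \<longleftrightarrow> pds is (g a) differentiable (at x)" if "x \<in> U" for "is" a x
    by (rule differentiable_cong_open[OF open_U that eq])
  with eq show ?thesis unfolding jets_def by simp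
qed

lemma jets_differentiable: "jets n f \<Longrightarrow> x \<in> U \<Longrightarrow> f a differentiable (at x)"
  using jets_mono[of n f 0] by (auto simp: jets_0)

lemma jets_const: "jets n (\<lambda>a x. c)"
proof (induction n arbitrary: c)
  case (Suc n)
  have "pd i (\<lambda>x::real^'n. c) = (\<lambda>x. 0)" for i by (rule ext) (rule pd_const)
  with Suc show ?case by (simp add: jets_Suc jets_0)
qed (simp add: jets_0)

lemma jets_add: "jets n f \<Longrightarrow> jets n g \<Longrightarrow> jets n (\<lambda>a x. f a x + g a x)"
proof (induction n arbitrary: f g)
  case 0
  then show ?case by (auto simp: jets_0 intro!: tendsto_add)
next
  case (Suc n)
  have "jets n (\<lambda>a. pd i (\<lambda>x. f a x + g a x)) \<longleftrightarrow> jets n (\<lambda>a x. pd i (f a) x + pd i (g a) x)" for i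
    using Suc.prems by (intro jets_cong pd_add) (auto intro: jets_differentiable)
  with Suc show ?case by (auto simp: jets_Suc) (auto simp: jets_0 intro!: tendsto_add)
qed

text \<open>The Leibniz rule brings back the undifferentiated factors, which
  \<open>jets_mono\<close> supplies at the lower order.\<close>

lemma jets_mult: "jets n f \<Longrightarrow> jets n g \<Longrightarrow> jets n (\<lambda>a x. f a x * g a x)"
proof (induction n arbitrary: f g)
  case 0
  then show ?case by (auto simp: jets_0 intro!: tendsto_mult)
next
  case (Suc n)
  have "jets n f" "jets n g" using Suc.prems by (auto intro: jets_mono)
  moreover have "jets n (\<lambda>a. pd i (f a))" "jets n (\<lambda>a. pd i (g a))" for i
    using Suc.prems by (auto simp: jets_Suc)
  ultimately have "jets n (\<lambda>a x. pd i (f a) x * g a x + f a x * pd i (g a) x)" for i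
    by (intro jets_add Suc.IH)
  moreover have "jets n (\<lambda>a. pd i (\<lambda>x. f a x * g a x)) \<longleftrightarrow>
      jets n (\<lambda>a x. pd i (f a) x * g a x + f a x * pd i (g a) x)" for i
    using Suc.prems by (intro jets_cong pd_mult) (auto intro: jets_differentiable)
  moreover have "jets 0 (\<lambda>a x. f a x * g a x)"
    using Suc.prems by (auto simp: jets_Suc) (auto simp: jets_0 intro!: tendsto_mult)
  ultimately show ?case by (auto simp: jets_Suc)
qed

lemma jets_uminus: "jets n f \<Longrightarrow> jets n (\<lambda>a x. - f a x)"
  using jets_mult[OF jets_const[of n "-1"]] by simp

text \<open>The derivative of the reciprocal contains the reciprocal itself, to which the induction
  hypothesis applies at the lower order. Nonvanishing gives differentiability at every index and, at
  \<open>a0\<close>, continuity of the reciprocal at the limit.\<close>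

lemma jets_inverse:
  "jets n f \<Longrightarrow> (\<And>a x. x \<in> U \<Longrightarrow> f a x \<noteq> 0) \<Longrightarrow> jets n (\<lambda>a x. inverse (f a x))"
proof (induction n arbitrary: f)
  case 0
  then show ?case by (auto simp: jets_0 intro!: tendsto_inverse)
next
  case (Suc n)
  have "jets n f" using Suc.prems by (auto intro: jets_mono)
  moreover have "jets n (\<lambda>a. pd i (f a))" for i
    using Suc.prems by (auto simp: jets_Suc)
  ultimately have "jets n (\<lambda>a x. - (pd i (f a) x * (inverse (f a x) * inverse (f a x))))" for i
    using Suc.prems by (intro jets_mult jets_uminus Suc.IH)
  moreover have "jets n (\<lambda>a. pd i (\<lambda>x. inverse (f a x))) \<longleftrightarrow>
      jets n (\<lambda>a x. - (pd i (f a) x * (inverse (f a x) * inverse (f a x))))" for i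
    using Suc.prems by (intro jets_cong pd_inverse) (auto intro: jets_differentiable)
  moreover have "jets 0 (\<lambda>a x. inverse (f a x))"
    using Suc.prems by (auto simp: jets_Suc) (auto simp: jets_0 intro!: tendsto_inverse)
  ultimately show ?case by (auto simp: jets_Suc)
qed

lemma jet_const: "jet (\<lambda>a x. c)"
  and jet_add: "jet f \<Longrightarrow> jet g \<Longrightarrow> jet (\<lambda>a x. f a x + g a x)"
  and jet_mult: "jet f \<Longrightarrow> jet g \<Longrightarrow> jet (\<lambda>a x. f a x * g a x)"
  and jet_uminus: "jet f \<Longrightarrow> jet (\<lambda>a x. - f a x)"
  and jet_inverse: "jet f \<Longrightarrow> (\<And>a x. x \<in> U \<Longrightarrow> f a x \<noteq> 0) \<Longrightarrow> jet (\<lambda>a x. inverse (f a x))"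
  by (auto simp: jet_def intro: jets_const jets_add jets_mult jets_uminus jets_inverse)

lemma jet_diff: "jet f \<Longrightarrow> jet g \<Longrightarrow> jet (\<lambda>a x. f a x - g a x)"
  using jet_add[OF _ jet_uminus, of f g] by simp

lemma jet_pd: "jet f \<Longrightarrow> jet (\<lambda>a x. pd i (f a) x)"
  unfolding jet_def by (metis jets_Suc)

lemma jet_sum: "(\<And>s. s \<in> S \<Longrightarrow> jet (f s)) \<Longrightarrow> jet (\<lambda>a x. \<Sum>s\<in>S. f s a x)"
proof (induction S rule: infinite_finite_induct)
  case (insert s S)
  then have "jet (\<lambda>a x. f s a x + (\<Sum>s\<in>S. f s a x))" by (intro jet_add) auto
  with insert show ?case by simp
qed (auto intro: jet_const)

lemma jet_prod: "(\<And>s. s \<in> S \<Longrightarrow> jet (f s)) \<Longrightarrow> jet (\<lambda>a x. \<Prod>s\<in>S. f s a x)"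
proof (induction S rule: infinite_finite_induct)
  case (insert s S)
  then have "jet (\<lambda>a x. f s a x * (\<Prod>s\<in>S. f s a x))" by (intro jet_mult) auto
  with insert show ?case by simp
qed (auto intro: jet_const)

lemma jet_cong: "(\<And>a x. x \<in> U \<Longrightarrow> f a x = g a x) \<Longrightarrow> jet f \<longleftrightarrow> jet g"
  unfolding jet_def using jets_cong by blast

lemma jet_differentiable: "jet f \<Longrightarrow> x \<in> U \<Longrightarrow> f a differentiable (at x)"
  unfolding jet_def using jets_differentiable by blast

lemma jet_tendsto: "jet f \<Longrightarrow> x \<in> U \<Longrightarrow> ((\<lambda>a. f a x) \<longlongrightarrow> f a0 x) F"
  unfolding jet_def using jets_0 by blast

lemma jet_det:
  assumes "\<And>i j. jet (\<lambda>a x. M a x $ i $ j)"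
  shows "jet (\<lambda>a x. det (M a x :: real^'m^'m))"
  unfolding det_def by (intro jet_sum jet_mult jet_const jet_prod assms)

end

section \<open>Inverse matrices and the convergence of curvature invariants\<close>

lemma invertible_matrix_inv:
  assumes "invertible (A :: real^'n^'n)"
  shows "A ** matrix_inv A = mat 1" "matrix_inv A ** A = mat 1"
  using assms someI_ex[of "\<lambda>A'. A ** A' = mat 1 \<and> A' ** A = mat 1"]
  unfolding invertible_def matrix_inv_def by auto

text \<open>Column \<open>l\<close> of the inverse solves a linear system whose right-hand side is a
  basis vector, so Cramer's rule applies. In this form the closure rules for sums, products and
  reciprocals reach the inverse metric.\<close>

lemma matrix_inv_cramer:
  fixes A :: "real^'n^'n"
  assumes "invertible A"
  shows "matrix_inv A $ k $ l = det (\<chi> i j. if j = k then axis l 1 $ i else A $ i $ j) * inverse (det A)"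
proof -
  have "A *v (matrix_inv A *v axis l 1) = axis l 1"
    by (simp add: matrix_vector_mul_assoc invertible_matrix_inv[OF assms])
  then have "matrix_inv A *v axis l 1 =
      (\<chi> k. det (\<chi> i j. if j = k then axis l 1 $ i else A $ i $ j) / det A)"
    using cramer[of A] assms by (simp add: invertible_det_nz)
  moreover have "(matrix_inv A *v axis l 1) $ k = matrix_inv A $ k $ l"
    by (simp add: matrix_vector_mult_def axis_def if_distrib cong: if_cong)
  ultimately show ?thesis by (simp add: divide_inverse)
qed

context jet_family
begin

context
  fixes G :: "'b \<Rightarrow> real^'n \<Rightarrow> real^'n^'n"
  assumes G: "\<And>i j. jet (\<lambda>a x. G a x $ i $ j)" and inv: "\<And>a x. x \<in> U \<Longrightarrow> invertible (G a x)"
begin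

lemma jet_matrix_inv: "jet (\<lambda>a x. matrix_inv (G a x) $ k $ l)"
proof -
  have "jet (\<lambda>a x. if j = k then axis l 1 $ i else G a x $ i $ j)" for i j
    by (cases "j = k") (simp_all add: jet_const G)
  then have "jet (\<lambda>a x. det (\<chi> i j. if j = k then axis l 1 $ i else G a x $ i $ j) * inverse (det (G a x)))"
    using inv by (intro jet_mult jet_inverse jet_det G) (auto simp: invertible_det_nz)
  then show ?thesis
    by (subst jet_cong[OF matrix_inv_cramer[OF inv]])
qed

lemma jet_christoffel: "jet (\<lambda>a x. christoffel (G a) x k i j)"
  unfolding christoffel_def
  by (intro jet_mult jet_const jet_sum jet_diff jet_add jet_matrix_inv jet_pd G)

lemma jet_riem_up: "jet (\<lambda>a x. riem_up (G a) x k i j l)"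
  unfolding riem_up_def
  by (intro jet_mult jet_sum jet_diff jet_add jet_pd jet_christoffel)

lemma jet_covR: "jet (\<lambda>a x. covR (G a) m x is)"
proof (induction m arbitrary: "is")
  case 0
  show ?case by (simp add: riem_def) (intro jet_sum jet_mult G jet_riem_up)
next
  case (Suc m)
  show ?case unfolding covR.simps nabla_def Let_def
    by (intro jet_diff jet_pd jet_sum jet_mult jet_christoffel Suc)
qed

lemma jet_prodT: "jet (\<lambda>a x. prodT (G a) ms x is)"
  by (induction ms arbitrary: "is") (auto intro!: jet_const jet_mult jet_covR)

lemma jet_full_contraction: "jet (\<lambda>a x. full_contraction (G a) ms \<sigma> x)"
  unfolding full_contraction_def by (intro jet_sum jet_mult jet_prod jet_prodT jet_matrix_inv)

lemma jet_curv_inv: "jet (\<lambda>a x. curv_inv P (G a) x)"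
proof -
  have "jet (\<lambda>a x. prod_list (map (\<lambda>(ms, \<sigma>). full_contraction (G a) ms \<sigma> x) mon))" for mon
    by (induction mon) (auto intro!: jet_const jet_mult jet_full_contraction)
  then show ?thesis unfolding curv_inv_def
    by (induction P) (auto intro!: jet_const jet_mult jet_add)
qed

end

end

subsection \<open>Pulling back the Christoffel symbols\<close>

text \<open>With a one-element index type, the closure rules for convergent families become a
  calculus of smooth functions.\<close>

lemma smooth_on_iff_jet:
  assumes "open U"
  shows "smooth_on U f \<longleftrightarrow> jet_family.jet U bot () (\<lambda>_. f)"
proof -
  interpret jet_family U "bot :: unit filter" "()" by standard (rule assms)
  show ?thesis unfolding smooth_on_def jet_def jets_def by auto
qed

text \<open>By the chain rule the first derivatives of the composite are sums of products of
  derivatives of \<open>\<phi>\<close> with composites \<open>pd k f\<close> after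
  \<open>\<phi>\<close>. Induction on the order, with \<open>f\<close> varying, therefore
  closes.\<close>

lemma smooth_on_compose:
  fixes f :: "real^'n \<Rightarrow> real" and \<phi> :: "real^'n \<Rightarrow> real^'n"
  assumes U: "open U" and f: "smooth_on U f" and \<phi>: "\<And>k. smooth_on U (\<lambda>x. \<phi> x $ k)"
    and \<phi>U: "\<And>x. x \<in> U \<Longrightarrow> \<phi> x \<in> U"
  shows "smooth_on U (\<lambda>x. f (\<phi> x))"
proof -
  interpret jet_family U "bot :: unit filter" "()" by standard (rule U)
  have \<phi>': "jet (\<lambda>_ x. \<phi> x $ k)" for k using \<phi> by (simp add: smooth_on_iff_jet[OF U])
  have diff: "(\<lambda>x. f (\<phi> x)) differentiable (at x)"
    if "\<And>y. y \<in> U \<Longrightarrow> f differentiable (at y)" "x \<in> U" for f :: "real^'n \<Rightarrow> real" and x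
  proof -
    have "\<phi> differentiable (at x)"
      by (rule differentiable_vec) (rule jet_differentiable[OF \<phi>' that(2)])
    then show ?thesis using that \<phi>U differentiable_chain_at[of \<phi> x f] by (simp add: o_def)
  qed
  \<comment> \<open>The induction needs sums at one fixed order, whereas \<open>jet_sum\<close>
    speaks of all orders at once.\<close>
  have sum: "jets n (\<lambda>a x. \<Sum>s\<in>S. h s a x)" if "\<And>s. jets n (h s)" for n and S :: "'n set" and h
    by (induction S rule: infinite_finite_induct) (auto intro!: jets_const jets_add that)
  have "jets n (\<lambda>_ x. f (\<phi> x))" if "jets n (\<lambda>_. f)" for n
    using that
  proof (induction n arbitrary: f)
    case 0
    then show ?case using diff by (auto simp: jets_0)
  next
    case (Suc n)
    have f: "f differentiable (at y)" if "y \<in> U" for y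
      using jets_differentiable[OF Suc.prems that] .
    have "jets n (\<lambda>_. pd i (\<lambda>x. f (\<phi> x))) \<longleftrightarrow>
        jets n (\<lambda>_ x. \<Sum>k\<in>UNIV. pd i (\<lambda>y. \<phi> y $ k) x * pd k f (\<phi> x))" for i
      by (intro jets_cong pd_compose f \<phi>U jet_differentiable[OF \<phi>'])
    moreover have "jets n (\<lambda>_ x. \<Sum>k\<in>UNIV. pd i (\<lambda>y. \<phi> y $ k) x * pd k f (\<phi> x))" for i
    proof (intro sum jets_mult Suc.IH)
      show "jets n (\<lambda>_ x. pd i (\<lambda>y. \<phi> y $ k) x)" for k
        using jet_pd[OF \<phi>'] by (simp add: jet_def)
      show "jets n (\<lambda>_. pd k f)" for k using Suc.prems by (simp add: jets_Suc)
    qed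
    ultimately show ?case using diff f by (auto simp: jets_Suc jets_0)
  qed
  with f show ?thesis unfolding smooth_on_iff_jet[OF U] jet_def by simp
qed

lemma sum_rotate3:
  "(\<Sum>k\<in>A. \<Sum>m\<in>B. \<Sum>e\<in>C. f k m e) = (\<Sum>e\<in>C. \<Sum>k\<in>A. \<Sum>m\<in>B. f k m e)"
proof -
  have "(\<Sum>k\<in>A. \<Sum>m\<in>B. \<Sum>e\<in>C. f k m e) = (\<Sum>k\<in>A. \<Sum>e\<in>C. \<Sum>m\<in>B. f k m e)"
    by (intro sum.cong refl sum.swap)
  also have "\<dots> = (\<Sum>e\<in>C. \<Sum>k\<in>A. \<Sum>m\<in>B. f k m e)" by (rule sum.swap)
  finally show ?thesis .
qed

lemma transpose_mul_nth:
  "(transpose A ** B ** C) $ i $ j = (\<Sum>k\<in>UNIV. \<Sum>l\<in>UNIV. A $ k $ i * C $ l $ j * (B :: real^'n^'n) $ k $ l)"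
  unfolding matrix_matrix_mult_def transpose_def
  by (simp add: sum_distrib_right sum_distrib_left)
    (subst sum.swap, simp add: mult_ac)

section \<open>The Jacobian and the pulled-back metric\<close>

locale metric_pullback =
  fixes U :: "(real^'n::finite) set" and g :: "real^'n \<Rightarrow> real^'n^'n" and \<phi> :: "real^'n \<Rightarrow> real^'n"
  assumes open_U: "open U" and g: "pseudo_riem_metric U g" and \<phi>: "diffeo_on U \<phi>"
begin

sublocale jet_family U "bot :: unit filter" "()"
  by standard (rule open_U)

abbreviation J :: "real^'n \<Rightarrow> 'n \<Rightarrow> 'n \<Rightarrow> real" where
  "J x k i \<equiv> pd i (\<lambda>y. \<phi> y $ k) x"

abbreviation h :: "real^'n \<Rightarrow> real^'n^'n" where
  "h \<equiv> pullback \<phi> g"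

lemma \<phi>_U: "x \<in> U \<Longrightarrow> \<phi> x \<in> U"
  using \<phi> by (auto simp: diffeo_on_def bij_betw_def)

lemma jet_\<phi>: "jet (\<lambda>_ x. \<phi> x $ k)"
  using \<phi> by (simp add: diffeo_on_def smooth_on_iff_jet[OF open_U])

lemma jet_compose: "jet (\<lambda>_. f) \<Longrightarrow> jet (\<lambda>_ x. f (\<phi> x))"
  using smooth_on_compose[OF open_U, of f \<phi>] \<phi>_U jet_\<phi>
  by (simp add: smooth_on_iff_jet[OF open_U])

lemma jet_J: "jet (\<lambda>_ x. J x k i)"
  by (rule jet_pd[OF jet_\<phi>])

lemma jet_g: "jet (\<lambda>_ x. g x $ i $ j)"
  using g by (simp add: pseudo_riem_metric_def smooth_on_iff_jet[OF open_U])

text \<open>The column index of the Jacobian is itself a direction of differentiation, so this is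
  Schwarz's theorem for component \<open>k\<close> of \<open>\<phi>\<close>.\<close>

lemma pd_J_commute:
  assumes "x \<in> U"
  shows "pd i (\<lambda>y. J y k j) x = pd j (\<lambda>y. J y k i) x"
proof (rule pd_commute[OF open_U assms])
  have "pd i (\<lambda>y. J y k j) differentiable (at x)" for i j
    using jet_differentiable[OF jet_pd[OF jet_J] assms] by simp
  then show "isCont (pd i (\<lambda>y. J y k j)) x" "isCont (pd j (\<lambda>y. J y k i)) x"
    by (simp_all add: differentiable_imp_continuous_within)
qed (use jet_differentiable[OF jet_\<phi>] jet_differentiable[OF jet_J] in simp_all)

lemma pd_compose_\<phi>:
  assumes "jet (\<lambda>_. f)" "x \<in> U"
  shows "pd i (\<lambda>y. f (\<phi> y)) x = (\<Sum>k\<in>UNIV. J x k i * pd k f (\<phi> x))"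
  by (intro pd_compose jet_differentiable[OF assms(1)] jet_differentiable[OF jet_\<phi>] \<phi>_U assms(2))

text \<open>Differentiating the identity \<open>\<psi> (\<phi> y) = y\<close> yields a left inverse,
  which suffices for a square matrix.\<close>

lemma invertible_J:
  assumes x: "x \<in> U"
  shows "invertible (\<chi> k i. J x k i)"
proof -
  define \<psi> where "\<psi> = inv_into U \<phi>"
  have \<psi>\<phi>: "\<psi> (\<phi> y) = y" if "y \<in> U" for y
    using \<phi> that by (auto simp: diffeo_on_def bij_betw_def \<psi>_def)
  have \<psi>: "jet (\<lambda>_ x. \<psi> x $ k)" for k
    using \<phi> by (simp add: diffeo_on_def smooth_on_iff_jet[OF open_U] \<psi>_def)
  have "(\<Sum>k\<in>UNIV. pd k (\<lambda>y. \<psi> y $ j) (\<phi> x) * J x k i) = (if j = i then 1 else 0)" for i j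
  proof -
    have "(\<Sum>k\<in>UNIV. J x k i * pd k (\<lambda>y. \<psi> y $ j) (\<phi> x)) = pd i (\<lambda>y. \<psi> (\<phi> y) $ j) x"
      by (rule pd_compose_\<phi>[OF \<psi> x, symmetric])
    also have "\<dots> = pd i (\<lambda>y. y $ j) x"
      by (rule pd_cong_open[OF open_U x]) (simp add: \<psi>\<phi>)
    also have "\<dots> = axis i 1 $ j"
      by (rule pd_eqI[OF bounded_linear_imp_has_derivative[OF bounded_linear_vec_nth]])
    finally show ?thesis by (simp add: mult.commute axis_def)
  qed
  then have "(\<chi> j k. pd k (\<lambda>y. \<psi> y $ j) (\<phi> x)) ** (\<chi> k i. J x k i) = mat 1"
    by (simp add: matrix_matrix_mult_def mat_def vec_eq_iff)
  then show ?thesis unfolding invertible_left_inverse by blast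
qed

lemma h_nth: "h x $ i $ j = (\<Sum>k\<in>UNIV. \<Sum>l\<in>UNIV. J x k i * J x l j * g (\<phi> x) $ k $ l)"
  by (simp add: pullback_def)

lemma h_matrix: "h x = transpose (\<chi> k i. J x k i) ** g (\<phi> x) ** (\<chi> k i. J x k i)"
  by (simp add: vec_eq_iff transpose_mul_nth h_nth)

lemma jet_h: "jet (\<lambda>_ x. h x $ i $ j)"
  unfolding h_nth by (intro jet_sum jet_mult jet_J jet_compose[OF jet_g])

lemma invertible_g: "x \<in> U \<Longrightarrow> invertible (g x)"
  using g by (simp add: pseudo_riem_metric_def)

lemma g_commute: "x \<in> U \<Longrightarrow> g x $ i $ j = g x $ j $ i"
  using g unfolding pseudo_riem_metric_def by (metis (no_types) transpose_def vec_lambda_beta)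

lemma invertible_h: "x \<in> U \<Longrightarrow> invertible (h x)"
  unfolding h_matrix by (intro invertible_mult transpose_invertible invertible_J invertible_g \<phi>_U)

text \<open>With \<open>h x = transpose M ** G ** M\<close>, inversion gives
  \<open>M ** H ** transpose M = matrix_inv G\<close>. Through this identity both the Christoffel
  symbols and the contractions are transformed with no entry of an inverse Jacobian in the
  result.\<close>

lemma J_matrix_inv_h:
  assumes x: "x \<in> U"
  shows "(\<Sum>k\<in>UNIV. \<Sum>l\<in>UNIV. J x a k * J x b l * matrix_inv (h x) $ k $ l) = matrix_inv (g (\<phi> x)) $ a $ b"
proof -
  define M where "M = (\<chi> k i. J x k i)"
  define H where "H = matrix_inv (h x)"
  define G where "G = g (\<phi> x)"
  have hx: "h x = transpose M ** G ** M" by (simp add: h_matrix M_def G_def)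
  have M: "invertible M" unfolding M_def by (rule invertible_J[OF x])
  then obtain M' where M': "M' ** M = mat 1" "M ** M' = mat 1" unfolding invertible_def by blast
  have T: "transpose M' ** transpose M = mat 1"
    using M'(2) by (metis matrix_transpose_mul transpose_mat)
  have "transpose M ** G ** M ** H = mat 1"
    unfolding hx[symmetric] H_def by (rule invertible_matrix_inv(1)[OF invertible_h[OF x]])
  \<comment> \<open>The outer factor \<open>transpose M\<close> is stripped on the left and then
    reappears on the right, so that \<open>M ** H ** transpose M\<close> is exhibited as a right
    inverse of \<open>G\<close>.\<close>
  then have "transpose M' ** (transpose M ** G ** M ** H) = transpose M'" by simp
  then have "G ** M ** H = transpose M'"
    by (simp add: matrix_mul_assoc T)
  then have "G ** (M ** H ** transpose M) = mat 1" by (simp add: matrix_mul_assoc T)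
  moreover have "matrix_inv G ** G = mat 1"
    unfolding G_def by (intro invertible_matrix_inv invertible_g \<phi>_U x)
  ultimately have "M ** H ** transpose M = matrix_inv G"
    by (metis matrix_mul_assoc matrix_mul_lid matrix_mul_rid)
  then have "(transpose (transpose M) ** H ** transpose M) $ a $ b = matrix_inv G $ a $ b" by simp
  then show ?thesis
    unfolding transpose_mul_nth by (simp add: transpose_def M_def H_def G_def)
qed

lemma pd_sum_jet:
  assumes "\<And>s. jet (\<lambda>_. f s)" "x \<in> U"
  shows "pd i (\<lambda>y. \<Sum>s\<in>(UNIV :: 'c::finite set). f s y) x = (\<Sum>s\<in>UNIV. pd i (f s) x)"
  by (intro pd_sum jet_differentiable[OF assms]) simp

lemma pd_mult_jet:
  assumes "jet (\<lambda>_. f1)" "jet (\<lambda>_. f2)" "x \<in> U"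
  shows "pd i (\<lambda>y. f1 y * f2 y) x = pd i f1 x * f2 x + f1 x * pd i f2 x"
  by (intro pd_mult jet_differentiable[OF assms(1)] jet_differentiable[OF assms(2)] assms(3))

lemma pd_add_jet:
  assumes "jet (\<lambda>_. f1)" "jet (\<lambda>_. f2)" "x \<in> U"
  shows "pd i (\<lambda>y. f1 y + f2 y) x = pd i f1 x + pd i f2 x"
  by (intro pd_add jet_differentiable[OF assms(1)] jet_differentiable[OF assms(2)] assms(3))

section \<open>The transformation law of the Christoffel symbols\<close>

lemma pd_h:
  assumes x: "x \<in> U"
  shows "pd i (\<lambda>y. h y $ j $ l) x =
      (\<Sum>k\<in>UNIV. \<Sum>m\<in>UNIV. pd i (\<lambda>y. J y k j) x * J x m l * g (\<phi> x) $ k $ m)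
    + (\<Sum>k\<in>UNIV. \<Sum>m\<in>UNIV. J x k j * pd i (\<lambda>y. J y m l) x * g (\<phi> x) $ k $ m)
    + (\<Sum>k\<in>UNIV. \<Sum>m\<in>UNIV. \<Sum>e\<in>UNIV. J x k j * J x m l * (J x e i * pd e (\<lambda>y. g y $ k $ m) (\<phi> x)))"
proof -
  have "pd i (\<lambda>y. h y $ j $ l) x =
    (\<Sum>k\<in>UNIV. \<Sum>m\<in>UNIV. pd i (\<lambda>y. J y k j * J y m l * g (\<phi> y) $ k $ m) x)"
    unfolding h_nth
    by (simp add: pd_sum_jet[OF _ x] jet_sum jet_mult jet_J jet_compose[OF jet_g])
  also have "\<dots> = (\<Sum>k\<in>UNIV. \<Sum>m\<in>UNIV. pd i (\<lambda>y. J y k j) x * J x m l * g (\<phi> x) $ k $ m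
      + J x k j * pd i (\<lambda>y. J y m l) x * g (\<phi> x) $ k $ m
      + (\<Sum>e\<in>UNIV. J x k j * J x m l * (J x e i * pd e (\<lambda>y. g y $ k $ m) (\<phi> x))))"
  proof (intro sum.cong refl)
    fix k m
    have "pd i (\<lambda>y. J y k j * J y m l * g (\<phi> y) $ k $ m) x =
      (pd i (\<lambda>y. J y k j) x * J x m l + J x k j * pd i (\<lambda>y. J y m l) x) * g (\<phi> x) $ k $ m
      + J x k j * J x m l * pd i (\<lambda>y. g (\<phi> y) $ k $ m) x"
      by (simp add: pd_mult_jet[OF _ _ x] jet_mult jet_J jet_compose[OF jet_g])
    also have "pd i (\<lambda>y. g (\<phi> y) $ k $ m) x = (\<Sum>e\<in>UNIV. J x e i * pd e (\<lambda>y. g y $ k $ m) (\<phi> x))"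
      by (rule pd_compose_\<phi>[OF jet_g x])
    finally show "pd i (\<lambda>y. J y k j * J y m l * g (\<phi> y) $ k $ m) x =
       pd i (\<lambda>y. J y k j) x * J x m l * g (\<phi> x) $ k $ m
      + J x k j * pd i (\<lambda>y. J y m l) x * g (\<phi> x) $ k $ m
      + (\<Sum>e\<in>UNIV. J x k j * J x m l * (J x e i * pd e (\<lambda>y. g y $ k $ m) (\<phi> x)))"
      by (simp add: distrib_right sum_distrib_left)
  qed
  finally show ?thesis by (simp add: sum.distrib)
qed

text \<open>Second derivatives of \<open>\<phi>\<close> enter through six terms \<open>S\<close>. As
  \<open>S i j l\<close> is symmetric in \<open>i\<close> and \<open>j\<close>, four of them cancel
  and the other two add up to \<open>2 * S i j l\<close>. The terms \<open>T\<close>, where the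
  metric is differentiated, combine into the same expression for \<open>g\<close>.\<close>

lemma christoffel_first_kind_h:
  assumes x: "x \<in> U"
  shows "pd i (\<lambda>y. h y $ j $ l) x + pd j (\<lambda>y. h y $ i $ l) x - pd l (\<lambda>y. h y $ i $ j) x =
    (\<Sum>m\<in>UNIV. J x m l * (2 * (\<Sum>k\<in>UNIV. pd i (\<lambda>y. J y k j) x * g (\<phi> x) $ k $ m) +
      (\<Sum>e\<in>UNIV. \<Sum>k\<in>UNIV. J x e i * J x k j * (pd e (\<lambda>y. g y $ k $ m) (\<phi> x)
         + pd k (\<lambda>y. g y $ e $ m) (\<phi> x) - pd m (\<lambda>y. g y $ e $ k) (\<phi> x)))))"
proof -
  define D where "D i k j = pd i (\<lambda>y. J y k j) x" for i k j
  define g' where "g' e k m = pd e (\<lambda>y. g y $ k $ m) (\<phi> x)" for e k m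
  define G where "G k m = g (\<phi> x) $ k $ m" for k m
  define I where "I k i = J x k i" for k i
  have D: "D i k j = D j k i" for i k j unfolding D_def by (rule pd_J_commute[OF x])
  have G: "G k m = G m k" for k m unfolding G_def by (rule g_commute[OF \<phi>_U[OF x]])
  define S where "S i j l = (\<Sum>k\<in>UNIV. \<Sum>m\<in>UNIV. D i k j * I m l * G k m)" for i j l
  define T where "T i j l = (\<Sum>k\<in>UNIV. \<Sum>m\<in>UNIV. \<Sum>e\<in>UNIV. I k j * I m l * (I e i * g' e k m))" for i j l
  have S2: "(\<Sum>k\<in>UNIV. \<Sum>m\<in>UNIV. I k j * D i m l * G k m) = S i l j" for i j l
  proof -
    have "(\<Sum>k\<in>UNIV. \<Sum>m\<in>UNIV. I k j * D i m l * G k m) = (\<Sum>m\<in>UNIV. \<Sum>k\<in>UNIV. D i m l * I k j * G m k)"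
      by (subst sum.swap) (simp add: mult_ac G)
    then show ?thesis by (simp add: S_def)
  qed
  have pd_h': "pd i (\<lambda>y. h y $ j $ l) x = S i j l + S i l j + T i j l" for i j l
  proof -
    have "pd i (\<lambda>y. h y $ j $ l) x = S i j l + (\<Sum>k\<in>UNIV. \<Sum>m\<in>UNIV. I k j * D i m l * G k m) + T i j l"
      unfolding S_def T_def D_def I_def G_def g'_def by (rule pd_h[OF x])
    then show ?thesis by (simp only: S2)
  qed
  have S_comm: "S i j l = S j i l" for i j l unfolding S_def by (simp only: D)
  \<comment> \<open>The three terms \<open>T\<close> are relabelled to one order of summation and
    one product of Jacobian entries, so that only the indices of \<open>g'\<close> differ.\<close>
  have T1: "T i j l = (\<Sum>m\<in>UNIV. \<Sum>e\<in>UNIV. \<Sum>k\<in>UNIV. I m l * (I e i * I k j * g' e k m))" for i j l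
    unfolding T_def by (subst sum_rotate3, subst sum_rotate3) (simp add: mult_ac)
  have T2: "T j i l = (\<Sum>m\<in>UNIV. \<Sum>e\<in>UNIV. \<Sum>k\<in>UNIV. I m l * (I e i * I k j * g' k e m))" for i j l
    unfolding T_def by (subst sum_rotate3, subst sum.swap, subst sum_rotate3) (simp add: mult_ac)
  have T3: "T l i j = (\<Sum>m\<in>UNIV. \<Sum>e\<in>UNIV. \<Sum>k\<in>UNIV. I m l * (I e i * I k j * g' m e k))" for i j l
    unfolding T_def by (subst sum_rotate3) (simp add: mult_ac)
  have eq: "S i j l + S i l j + T i j l + (S j i l + S j l i + T j i l) - (S l i j + S l j i + T l i j)
      = 2 * S i j l + (T i j l + T j i l - T l i j)"
    using S_comm[of l i j] S_comm[of l j i] S_comm[of j i l] by simp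
  have S: "S i j l = (\<Sum>m\<in>UNIV. I m l * (\<Sum>k\<in>UNIV. D i k j * G k m))"
    unfolding S_def by (subst sum.swap) (simp add: sum_distrib_left mult_ac)
  have T: "T i j l + T j i l - T l i j =
     (\<Sum>m\<in>UNIV. I m l * (\<Sum>e\<in>UNIV. \<Sum>k\<in>UNIV. I e i * I k j * (g' e k m + g' k e m - g' m e k)))"
    unfolding T1[of i j l] T2[of j i l] T3[of l i j]
    by (simp add: sum_distrib_left distrib_left right_diff_distrib sum.distrib sum_subtractf)
  show ?thesis
    unfolding pd_h' eq unfolding S T D_def[symmetric] G_def[symmetric] I_def[symmetric] g'_def[symmetric]
    by (simp add: distrib_left sum.distrib sum_distrib_left mult_ac)
qed

text \<open>The expression of the first kind carries a factor \<open>J x m l\<close>. Together with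
  the factor \<open>J x a k\<close> on the left it turns the inverse of \<open>h\<close> into the
  inverse of \<open>g\<close>, by \<open>J_matrix_inv_h\<close>.\<close>

lemma christoffel_h:
  assumes x: "x \<in> U"
  shows "(\<Sum>k\<in>UNIV. J x a k * christoffel h x k i j) = pd i (\<lambda>y. J y a j) x +
    (\<Sum>b\<in>UNIV. \<Sum>c\<in>UNIV. J x b i * J x c j * christoffel g (\<phi> x) a b c)"
proof -
  define C where "C m = (\<Sum>e\<in>UNIV. \<Sum>k\<in>UNIV. J x e i * J x k j * (pd e (\<lambda>y. g y $ k $ m) (\<phi> x)
         + pd k (\<lambda>y. g y $ e $ m) (\<phi> x) - pd m (\<lambda>y. g y $ e $ k) (\<phi> x)))" for m
  define E where "E m = 2 * (\<Sum>k\<in>UNIV. pd i (\<lambda>y. J y k j) x * g (\<phi> x) $ k $ m) + C m" for m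
  define G where "G = g (\<phi> x)"
  have inv: "(\<Sum>m\<in>UNIV. matrix_inv G $ a $ m * G $ m $ k) = (if a = k then 1 else 0)" for k
    using invertible_matrix_inv(2)[OF invertible_g[OF \<phi>_U[OF x]]]
    by (simp add: vec_eq_iff matrix_matrix_mult_def mat_def G_def)
  have "(\<Sum>k\<in>UNIV. J x a k * christoffel h x k i j) =
      (1/2) * (\<Sum>k\<in>UNIV. \<Sum>l\<in>UNIV. J x a k * (matrix_inv (h x) $ k $ l * (\<Sum>m\<in>UNIV. J x m l * E m)))"
    unfolding christoffel_def christoffel_first_kind_h[OF x] C_def[symmetric] E_def[symmetric]
    by (simp add: sum_distrib_left mult_ac)
  also have "(\<Sum>k\<in>UNIV. \<Sum>l\<in>UNIV. J x a k * (matrix_inv (h x) $ k $ l * (\<Sum>m\<in>UNIV. J x m l * E m))) =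
      (\<Sum>m\<in>UNIV. (\<Sum>k\<in>UNIV. \<Sum>l\<in>UNIV. J x a k * J x m l * matrix_inv (h x) $ k $ l) * E m)"
    unfolding sum_distrib_left sum_distrib_right by (subst sum_rotate3) (simp add: mult_ac)
  also have "\<dots> = (\<Sum>m\<in>UNIV. matrix_inv G $ a $ m * E m)"
    unfolding J_matrix_inv_h[OF x] G_def ..
  also have "\<dots> = 2 * (\<Sum>m\<in>UNIV. matrix_inv G $ a $ m * (\<Sum>k\<in>UNIV. pd i (\<lambda>y. J y k j) x * G $ k $ m))
      + (\<Sum>m\<in>UNIV. matrix_inv G $ a $ m * C m)"
    unfolding E_def G_def by (simp add: distrib_left sum.distrib sum_distrib_left mult_ac)
  \<comment> \<open>Here the metric meets its own inverse, which leaves the bare second derivative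
    of component \<open>a\<close> of \<open>\<phi>\<close>.\<close>
  also have "(\<Sum>m\<in>UNIV. matrix_inv G $ a $ m * (\<Sum>k\<in>UNIV. pd i (\<lambda>y. J y k j) x * G $ k $ m))
      = (\<Sum>k\<in>UNIV. pd i (\<lambda>y. J y k j) x * (\<Sum>m\<in>UNIV. matrix_inv G $ a $ m * G $ m $ k))"
    unfolding sum_distrib_left
    by (subst sum.swap) (simp add: mult_ac G_def g_commute[OF \<phi>_U[OF x]])
  also have "\<dots> = pd i (\<lambda>y. J y a j) x"
    unfolding inv by (simp add: if_distrib cong: if_cong)
  also have "(\<Sum>m\<in>UNIV. matrix_inv G $ a $ m * C m) =
      2 * (\<Sum>b\<in>UNIV. \<Sum>c\<in>UNIV. J x b i * J x c j * christoffel g (\<phi> x) a b c)"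
    unfolding C_def christoffel_def G_def[symmetric] sum_distrib_left
    by (subst (2) sum_rotate3) (simp add: mult_ac)
  finally show ?thesis by simp
qed

end

subsection \<open>Pulling back the curvature\<close>

lemma matrix_add_rdistrib: "(A + B :: real^'n^'m) ** C = A ** C + B ** C"
  by (simp add: matrix_matrix_mult_def vec_eq_iff distrib_right sum.distrib)

lemma matrix_diff_ldistrib: "(A :: real^'n^'m) ** (B - C) = A ** B - A ** C"
  by (simp add: matrix_matrix_mult_def vec_eq_iff right_diff_distrib sum_subtractf)

lemma matrix_diff_rdistrib: "(A - B :: real^'n^'m) ** C = A ** C - B ** C"
  by (simp add: matrix_matrix_mult_def vec_eq_iff left_diff_distrib sum_subtractf)

text \<open>Equivariance of curvature under the gauge transformation \<open>M A = dM + B M\<close> of connection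
  matrices; the second hypothesis is the derivative of that relation.\<close>

lemma curvature_gauge_transform:
  fixes M :: "real^'n^'n" and A B dM :: "'n \<Rightarrow> real^'n^'n" and dA dB ddM :: "'n \<Rightarrow> 'n \<Rightarrow> real^'n^'n"
  assumes A: "\<And>c. M ** A c = dM c + B c ** M"
    and dA: "\<And>d c. dM d ** A c + M ** dA d c = ddM d c + (dB d c ** M + B c ** dM d)"
    and sym: "ddM c d = ddM d c"
  shows "M ** (dA c d - dA d c + (A c ** A d - A d ** A c)) =
    (dB c d - dB d c + (B c ** B d - B d ** B c)) ** M"
proof -
  have dM: "dM c = M ** A c - B c ** M" for c using A[of c] by simp
  have dA': "M ** dA d c = ddM d c + (dB d c ** M + B c ** dM d) - dM d ** A c" for c d
    using dA[of d c] by (simp add: algebra_simps)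
  \<comment> \<open>Replacing each \<open>M ** dA\<close> makes the \<open>ddM\<close> terms cancel
    by \<open>sym\<close>; replacing \<open>dM\<close> afterwards makes the remaining products
    match.\<close>
  show ?thesis
    unfolding matrix_add_ldistrib matrix_add_rdistrib matrix_diff_ldistrib matrix_diff_rdistrib dA' sym
    unfolding dM matrix_diff_ldistrib matrix_diff_rdistrib matrix_mul_assoc
    by simp
qed

context metric_pullback
begin

lemma jet_christoffel_h: "jet (\<lambda>_ x. christoffel h x k i j)"
  by (rule jet_christoffel[OF jet_h invertible_h])

lemma jet_christoffel_g: "jet (\<lambda>_ x. christoffel g x k i j)"
  by (rule jet_christoffel[OF jet_g invertible_g])

text \<open>The connection form of \<open>g\<close> pulled back along \<open>\<phi>\<close>, the
  matrices \<open>B\<close> of the overview. Only the form index \<open>i\<close> is transformed;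
  \<open>k\<close> and \<open>j\<close> still refer to the coordinates at
  \<open>\<phi> x\<close>.\<close>

definition conn :: "'n \<Rightarrow> real^'n \<Rightarrow> 'n \<Rightarrow> 'n \<Rightarrow> real" where
  "conn i x k j = (\<Sum>d\<in>UNIV. J x d i * christoffel g (\<phi> x) k d j)"

lemma jet_conn: "jet (\<lambda>_ x. conn i x k j)"
  unfolding conn_def by (intro jet_sum jet_mult jet_J jet_compose[OF jet_christoffel_g])

lemma J_christoffel_h:
  assumes "x \<in> U"
  shows "(\<Sum>l\<in>UNIV. J x k l * christoffel h x l i j) =
    pd i (\<lambda>y. J y k j) x + (\<Sum>l\<in>UNIV. conn i x k l * J x l j)"
proof -
  have "(\<Sum>b\<in>UNIV. \<Sum>c\<in>UNIV. J x b i * J x c j * christoffel g (\<phi> x) k b c) =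
      (\<Sum>l\<in>UNIV. conn i x k l * J x l j)"
    unfolding conn_def sum_distrib_right by (subst sum.swap) (simp add: mult_ac)
  then show ?thesis using christoffel_h[OF assms] by simp
qed

lemma pd_conn:
  assumes x: "x \<in> U"
  shows "pd c (\<lambda>y. conn d y a b) x = (\<Sum>e\<in>UNIV. pd c (\<lambda>y. J y e d) x * christoffel g (\<phi> x) a e b)
    + (\<Sum>e\<in>UNIV. \<Sum>f\<in>UNIV. J x e c * J x f d * pd e (\<lambda>y. christoffel g y a f b) (\<phi> x))"
proof -
  have "pd c (\<lambda>y. conn d y a b) x = (\<Sum>e\<in>UNIV. pd c (\<lambda>y. J y e d) x * christoffel g (\<phi> x) a e b
     + J x e d * (\<Sum>f\<in>UNIV. J x f c * pd f (\<lambda>y. christoffel g y a e b) (\<phi> x)))"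
    unfolding conn_def
    by (simp add: pd_sum_jet[OF _ x] pd_mult_jet[OF _ _ x] jet_mult jet_J jet_compose[OF jet_christoffel_g]
        pd_compose_\<phi>[OF jet_christoffel_g x])
  also have "(\<Sum>e\<in>UNIV. J x e d * (\<Sum>f\<in>UNIV. J x f c * pd f (\<lambda>y. christoffel g y a e b) (\<phi> x))) =
      (\<Sum>e\<in>UNIV. \<Sum>f\<in>UNIV. J x e c * J x f d * pd e (\<lambda>y. christoffel g y a f b) (\<phi> x))"
    unfolding sum_distrib_left by (subst sum.swap) (simp add: mult_ac)
  ultimately show ?thesis by (simp add: sum.distrib)
qed

text \<open>Curvature commutes with the pullback of connection forms: the summand of
  \<open>pd_conn\<close> containing second derivatives of \<open>\<phi>\<close> is symmetric in
  \<open>c\<close> and \<open>d\<close> and drops out of the difference.\<close>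

lemma curvature_conn:
  assumes x: "x \<in> U"
  shows "pd c (\<lambda>y. conn d y a b) x - pd d (\<lambda>y. conn c y a b) x
      + ((\<Sum>m\<in>UNIV. conn c x a m * conn d x m b) - (\<Sum>m\<in>UNIV. conn d x a m * conn c x m b)) =
    (\<Sum>e\<in>UNIV. \<Sum>f\<in>UNIV. J x e c * J x f d * riem_up g (\<phi> x) a b e f)"
proof -
  have 1: "pd d (\<lambda>y. conn c y a b) x = (\<Sum>e\<in>UNIV. pd c (\<lambda>y. J y e d) x * christoffel g (\<phi> x) a e b)
    + (\<Sum>e\<in>UNIV. \<Sum>f\<in>UNIV. J x e c * J x f d * pd f (\<lambda>y. christoffel g y a e b) (\<phi> x))"
    unfolding pd_conn[OF x] by (subst (2) sum.swap) (simp add: pd_J_commute[OF x] mult_ac)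
  have 2: "(\<Sum>m\<in>UNIV. conn c x a m * conn d x m b) = (\<Sum>e\<in>UNIV. \<Sum>f\<in>UNIV. J x e c * J x f d *
      (\<Sum>m\<in>UNIV. christoffel g (\<phi> x) a e m * christoffel g (\<phi> x) m f b))" for c d
  proof -
    have "(\<Sum>m\<in>UNIV. conn c x a m * conn d x m b) = (\<Sum>m\<in>UNIV. \<Sum>e\<in>UNIV. \<Sum>f\<in>UNIV. J x e c * J x f d *
      (christoffel g (\<phi> x) a e m * christoffel g (\<phi> x) m f b))"
      unfolding conn_def sum_product by (simp add: mult_ac)
    also have "\<dots> = (\<Sum>e\<in>UNIV. \<Sum>f\<in>UNIV. \<Sum>m\<in>UNIV. J x e c * J x f d *
      (christoffel g (\<phi> x) a e m * christoffel g (\<phi> x) m f b))"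
      by (rule sum_rotate3[symmetric])
    finally show ?thesis by (simp add: sum_distrib_left)
  qed
  have 3: "(\<Sum>m\<in>UNIV. conn d x a m * conn c x m b) = (\<Sum>e\<in>UNIV. \<Sum>f\<in>UNIV. J x e c * J x f d *
      (\<Sum>m\<in>UNIV. christoffel g (\<phi> x) a f m * christoffel g (\<phi> x) m e b))"
    unfolding 2 by (subst sum.swap) (simp add: mult_ac)
  show ?thesis
    unfolding pd_conn[OF x, of c d] 1 2[of c d] 3 riem_up_def
    by (simp add: distrib_left right_diff_distrib sum.distrib sum_subtractf)
qed

text \<open>An instance of \<open>curvature_gauge_transform\<close>, with the Christoffel matrices
  of \<open>h\<close> as \<open>A\<close> and \<open>conn\<close> as \<open>B\<close>. Keeping the
  Jacobian on the left avoids its inverse.\<close>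

lemma riem_up_h:
  assumes x: "x \<in> U"
  shows "(\<Sum>e\<in>UNIV. J x a e * riem_up h x e b c d) =
    (\<Sum>m\<in>UNIV. (\<Sum>e\<in>UNIV. \<Sum>f\<in>UNIV. J x e c * J x f d * riem_up g (\<phi> x) a m e f) * J x m b)"
proof -
  define M where "M = (\<chi> k i. J x k i)"
  define A where "A c = (\<chi> k b. christoffel h x k c b)" for c
  define B where "B c = (\<chi> k b. conn c x k b)" for c
  define dM where "dM c = (\<chi> k b. pd c (\<lambda>y. J y k b) x)" for c
  define dA where "dA d c = (\<chi> k b. pd d (\<lambda>y. christoffel h y k c b) x)" for d c
  define dB where "dB d c = (\<chi> k b. pd d (\<lambda>y. conn c y k b) x)" for d c
  define ddM where "ddM d c = (\<chi> k b. pd d (\<lambda>y. pd c (\<lambda>y. J y k b) y) x)" for d c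
  note defs = M_def A_def B_def dM_def dA_def dB_def ddM_def
  have MA: "M ** A c = dM c + B c ** M" for c
    using J_christoffel_h[OF x] unfolding defs by (simp add: vec_eq_iff matrix_matrix_mult_def)
  have dMA: "dM d ** A c + M ** dA d c = ddM d c + (dB d c ** M + B c ** dM d)" for d c
  proof -
    have "(\<Sum>l\<in>UNIV. pd d (\<lambda>y. J y k l) x * christoffel h x l c j) +
        (\<Sum>l\<in>UNIV. J x k l * pd d (\<lambda>y. christoffel h y l c j) x) =
       pd d (\<lambda>y. pd c (\<lambda>y. J y k j) y) x + ((\<Sum>l\<in>UNIV. pd d (\<lambda>y. conn c y k l) x * J x l j) +
       (\<Sum>l\<in>UNIV. conn c x k l * pd d (\<lambda>y. J y l j) x))" for k j
    proof -
      have "(\<Sum>l\<in>UNIV. pd d (\<lambda>y. J y k l) x * christoffel h x l c j) +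
        (\<Sum>l\<in>UNIV. J x k l * pd d (\<lambda>y. christoffel h y l c j) x) =
        pd d (\<lambda>y. \<Sum>l\<in>UNIV. J y k l * christoffel h y l c j) x"
        by (simp add: pd_sum_jet[OF _ x] pd_mult_jet[OF _ _ x] jet_mult jet_J jet_christoffel_h sum.distrib)
      \<comment> \<open>The transformation law holds on the whole open set \<open>U\<close>, so both
        of its sides may be differentiated at \<open>x\<close>.\<close>
      also have "\<dots> = pd d (\<lambda>y. pd c (\<lambda>y. J y k j) y + (\<Sum>l\<in>UNIV. conn c y k l * J y l j)) x"
        by (rule pd_cong_open[OF open_U x]) (rule J_christoffel_h)
      also have "\<dots> = pd d (\<lambda>y. pd c (\<lambda>y. J y k j) y) x + pd d (\<lambda>y. \<Sum>l\<in>UNIV. conn c y k l * J y l j) x"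
        by (intro pd_add_jet[OF _ _ x] jet_pd[OF jet_J] jet_sum jet_mult jet_conn jet_J)
      also have "pd d (\<lambda>y. \<Sum>l\<in>UNIV. conn c y k l * J y l j) x =
         (\<Sum>l\<in>UNIV. pd d (\<lambda>y. conn c y k l) x * J x l j) +
         (\<Sum>l\<in>UNIV. conn c x k l * pd d (\<lambda>y. J y l j) x)"
        by (simp add: pd_sum_jet[OF _ x] pd_mult_jet[OF _ _ x] jet_mult jet_J jet_conn sum.distrib)
      finally show ?thesis .
    qed
    then show ?thesis
      unfolding defs by (simp add: vec_eq_iff matrix_matrix_mult_def)
  qed
  \<comment> \<open>These are third derivatives of \<open>\<phi>\<close>, so Schwarz's theorem is
    applied to entries of the Jacobian.\<close>
  have ddM: "ddM c d = ddM d c"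
  proof -
    have diff: "(\<lambda>y. J y k b) differentiable (at y)" "pd c (\<lambda>y. J y k b) differentiable (at y)"
      "pd d (\<lambda>y. J y k b) differentiable (at y)"
      "pd c (pd d (\<lambda>y. J y k b)) differentiable (at y)" "pd d (pd c (\<lambda>y. J y k b)) differentiable (at y)"
      if "y \<in> U" for k b y
      using jet_differentiable[OF jet_J that] jet_differentiable[OF jet_pd[OF jet_J] that]
        jet_differentiable[OF jet_pd[OF jet_pd[OF jet_J]] that] by simp_all
    have "pd c (pd d (\<lambda>y. J y k b)) x = pd d (pd c (\<lambda>y. J y k b)) x" for k b
      by (rule pd_commute[OF open_U x]) (use diff x in \<open>simp_all add: differentiable_imp_continuous_within\<close>)
    then show ?thesis by (simp add: ddM_def vec_eq_iff)
  qed
  have "(M ** (dA c d - dA d c + (A c ** A d - A d ** A c))) $ a $ b =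
    ((dB c d - dB d c + (B c ** B d - B d ** B c)) ** M) $ a $ b"
    by (simp only: curvature_gauge_transform[of M A dM B dA ddM dB c d, OF MA dMA ddM])
  moreover have "(M ** (dA c d - dA d c + (A c ** A d - A d ** A c))) $ a $ b =
      (\<Sum>e\<in>UNIV. J x a e * riem_up h x e b c d)"
    unfolding defs riem_up_def by (simp add: matrix_matrix_mult_def sum_subtractf)
  moreover have "((dB c d - dB d c + (B c ** B d - B d ** B c)) ** M) $ a $ b =
      (\<Sum>m\<in>UNIV. (\<Sum>e\<in>UNIV. \<Sum>f\<in>UNIV. J x e c * J x f d * riem_up g (\<phi> x) a m e f) * J x m b)"
    unfolding curvature_conn[OF x, symmetric] unfolding defs
    by (simp add: matrix_matrix_mult_def)
  ultimately show ?thesis by simp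
qed

end

subsection \<open>Covariant tensors and their contractions\<close>

text \<open>The components of a covariant tensor \<open>T\<close> pulled back by the Jacobian \<open>J\<close>, the derivative of this
  pullback when \<open>J\<close> varies in the direction \<open>D\<close>, and the connection term of the covariant
  derivative of \<open>T\<close>. Recursion on the index list makes all three amenable to induction
  without bookkeeping of positions.\<close>

fun pull :: "('n \<Rightarrow> 'n \<Rightarrow> real) \<Rightarrow> ('n list \<Rightarrow> real) \<Rightarrow> 'n::finite list \<Rightarrow> real" where
  "pull J T [] = T []"
| "pull J T (i # is) = (\<Sum>k\<in>UNIV. J k i * pull J (\<lambda>ks. T (k # ks)) is)"

fun dpull :: "('n \<Rightarrow> 'n \<Rightarrow> real) \<Rightarrow> ('n \<Rightarrow> 'n \<Rightarrow> real) \<Rightarrow> ('n list \<Rightarrow> real) \<Rightarrow> 'n::finite list \<Rightarrow> real" where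
  "dpull J D T [] = 0"
| "dpull J D T (i # is) = (\<Sum>k\<in>UNIV. D k i * pull J (\<lambda>ks. T (k # ks)) is
     + J k i * dpull J D (\<lambda>ks. T (k # ks)) is)"

fun corr :: "('n \<Rightarrow> 'n \<Rightarrow> real) \<Rightarrow> ('n list \<Rightarrow> real) \<Rightarrow> 'n::finite list \<Rightarrow> real" where
  "corr A T [] = 0"
| "corr A T (j # js) = (\<Sum>l\<in>UNIV. A l j * T (l # js)) + corr A (\<lambda>ks. T (j # ks)) js"

text \<open>Links the recursion to the sum over index positions that occurs in
  \<open>nabla\<close>.\<close>

lemma corr_eq: "corr A T js = (\<Sum>r<length js. \<Sum>l\<in>UNIV. A l (js ! r) * T (js[r := l]))"
  by (induction js arbitrary: T) (simp_all add: sum.lessThan_Suc_shift del: sum.lessThan_Suc)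

lemma nabla_Cons:
  "nabla g T x (i # js) = pd i (\<lambda>y. T y js) x - corr (\<lambda>l j. christoffel g x l i j) (T x) js"
  by (simp add: nabla_def corr_eq)

lemma corr_cong: "(\<And>ks. length ks = length is \<Longrightarrow> S ks = T ks) \<Longrightarrow> corr A S is = corr A T is"
  by (simp add: corr_eq)

lemma pull_add: "pull J (\<lambda>ks. S ks + T ks) is = pull J S is + pull J T is"
  by (induction "is" arbitrary: S T) (simp_all add: distrib_left sum.distrib)

lemma pull_cmult: "pull J (\<lambda>ks. c * T ks) is = c * pull J T is"
  by (induction "is" arbitrary: T) (simp_all add: sum_distrib_left mult_ac)

lemma pull_diff: "pull J (\<lambda>ks. S ks - T ks) is = pull J S is - pull J T is"
  using pull_add[of J S "\<lambda>ks. (-1) * T ks"] pull_cmult[of J "-1" T] by simp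

lemma pull_sum: "pull J (\<lambda>ks. \<Sum>s\<in>S. T s ks) is = (\<Sum>s\<in>S. pull J (T s) is)"
proof (induction S rule: infinite_finite_induct)
  case empty
  show ?case using pull_cmult[of J 0 "\<lambda>_. 0"] by simp
next
  case (infinite S)
  then show ?case using pull_cmult[of J 0 "\<lambda>_. 0"] by simp
qed (simp add: pull_add)

lemma corr_sum_cmult: "corr A (\<lambda>ks. \<Sum>s\<in>S. c s * T s ks) is = (\<Sum>s\<in>S. c s * corr A (T s) is)"
proof (induction "is" arbitrary: T)
  case (Cons i "is")
  have "(\<Sum>l\<in>UNIV. A l i * (\<Sum>s\<in>S. c s * T s (l # is))) = (\<Sum>s\<in>S. c s * (\<Sum>l\<in>UNIV. A l i * T s (l # is)))"
    unfolding sum_distrib_left by (subst sum.swap) (simp add: mult_ac)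
  with Cons show ?case by (simp add: distrib_left sum.distrib)
qed simp

lemma corr_sum_connection: "corr (\<lambda>l j. \<Sum>s\<in>S. c s * A s l j) T is = (\<Sum>s\<in>S. c s * corr (A s) T is)"
proof (induction "is" arbitrary: T)
  case (Cons i "is")
  have "(\<Sum>l\<in>UNIV. (\<Sum>s\<in>S. c s * A s l i) * T (l # is)) = (\<Sum>s\<in>S. c s * (\<Sum>l\<in>UNIV. A s l i * T (l # is)))"
    unfolding sum_distrib_left sum_distrib_right by (subst sum.swap) (simp add: mult_ac)
  with Cons show ?case by (simp add: distrib_left sum.distrib)
qed simp

text \<open>In each slot the gauge relation moves the connection past the Jacobian and leaves an
  inhomogeneous term \<open>D\<close>. These terms add up to \<open>dpull\<close>, which is also
  what differentiating the Jacobians in a pullback produces.\<close>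

lemma corr_pull:
  assumes "\<And>k j. (\<Sum>l\<in>UNIV. J k l * A l j) = D k j + (\<Sum>l\<in>UNIV. B k l * J l j)"
  shows "corr A (pull J T) is = pull J (corr B T) is + dpull J D T is"
proof (induction "is" arbitrary: T)
  case (Cons j js)
  define P where "P k = pull J (\<lambda>ks. T (k # ks)) js" for k
  have "(\<Sum>l\<in>UNIV. A l j * (\<Sum>k\<in>UNIV. J k l * P k)) = (\<Sum>k\<in>UNIV. (\<Sum>l\<in>UNIV. J k l * A l j) * P k)"
    unfolding sum_distrib_left sum_distrib_right by (subst sum.swap) (simp add: mult_ac)
  also have "\<dots> = (\<Sum>k\<in>UNIV. D k j * P k) + (\<Sum>k\<in>UNIV. \<Sum>l\<in>UNIV. B k l * J l j * P k)"
    unfolding assms by (simp add: distrib_right sum.distrib sum_distrib_right)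
  also have "(\<Sum>k\<in>UNIV. \<Sum>l\<in>UNIV. B k l * J l j * P k) = (\<Sum>k\<in>UNIV. J k j * (\<Sum>l\<in>UNIV. B l k * P l))"
    unfolding sum_distrib_left by (subst sum.swap) (simp add: mult_ac)
  finally have 1: "(\<Sum>l\<in>UNIV. A l j * pull J T (l # js)) =
      (\<Sum>k\<in>UNIV. D k j * P k) + (\<Sum>k\<in>UNIV. J k j * (\<Sum>l\<in>UNIV. B l k * P l))"
    by (simp add: P_def)
  have 2: "corr A (\<lambda>ks. pull J T (j # ks)) js = (\<Sum>k\<in>UNIV. J k j * (pull J (corr B (\<lambda>ks. T (k # ks))) js
      + dpull J D (\<lambda>ks. T (k # ks)) js))"
    using corr_sum_cmult[of A "\<lambda>k. J k j" "\<lambda>k. pull J (\<lambda>ks. T (k # ks))" UNIV js]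
    by (simp add: Cons)
  have 3: "pull J (\<lambda>ks. corr B T (k # ks)) js = (\<Sum>l\<in>UNIV. B l k * P l) + pull J (corr B (\<lambda>ks. T (k # ks))) js" for k
    by (simp add: pull_add pull_sum pull_cmult P_def)
  show ?case
    unfolding corr.simps(2)[of A "pull J T"] 1 2 pull.simps(2)[of J "corr B T"] 3 dpull.simps P_def[symmetric]
    by (simp add: distrib_left sum.distrib)
qed simp

text \<open>Pullback is multiplicative on tensor products; \<open>prodT\<close> cuts its index list
  in this way.\<close>

lemma pull_append:
  assumes "n \<le> length is"
  shows "pull J (\<lambda>ks. S (take n ks) * T (drop n ks)) is = pull J S (take n is) * pull J T (drop n is)"
  using assms
proof (induction n arbitrary: "is" S)
  case 0
  then show ?case by (simp add: pull_cmult)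
next
  case (Suc n)
  then obtain i js where "is = i # js" "n \<le> length js" by (cases "is") auto
  moreover have "pull J (\<lambda>ks. S (k # take n ks) * T (drop n ks)) js =
      pull J (\<lambda>ks. S (k # ks)) (take n js) * pull J T (drop n js)" for k
    by (rule Suc.IH) fact
  ultimately show ?case by (simp add: sum_distrib_right mult.assoc)
qed

section \<open>Full contractions of pulled-back tensors\<close>

lemma sum_lists_Suc:
  "(\<Sum>js | length js = Suc n. f js) = (\<Sum>k\<in>(UNIV :: 'n::finite set). \<Sum>js | length js = n. f (k # js))"
proof -
  have "(\<Sum>k\<in>(UNIV :: 'n set). \<Sum>js | length js = n. f (k # js)) =
      (\<Sum>(k, js)\<in>UNIV \<times> {js. length js = n}. f (k # js))"
    by (rule sum.cartesian_product)
  also have "\<dots> = (\<Sum>js | length js = Suc n. f js)"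
    by (rule sum.reindex_bij_witness[of _ "\<lambda>js. (hd js, tl js)" "\<lambda>(k, js). k # js"])
       (auto simp: length_Suc_conv)
  finally show ?thesis by simp
qed

text \<open>A pairing joins slots at arbitrary positions, so contractions need this positional form
  instead of the recursion.\<close>

lemma pull_eq_sum:
  "pull J T is = (\<Sum>js | length js = length is. (\<Prod>b<length is. J (js ! b) (is ! b)) * T js)"
proof (induction "is" arbitrary: T)
  case (Cons i "is")
  then show ?case
    by (simp add: sum_lists_Suc prod.lessThan_Suc_shift sum_distrib_left mult_ac del: prod.lessThan_Suc)
qed simp

text \<open>A list of length \<open>N\<close> amounts to an independent choice of two entries for
  each pair of positions; the claim is then the distributive law. \<open>A\<close> holds the smaller
  position of each pair.\<close>

lemma sum_lists_pairing:
  fixes q :: "nat \<Rightarrow> 'n::finite \<Rightarrow> 'n \<Rightarrow> real"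
  assumes \<sigma>: "valid_pairing N \<sigma>"
  defines "A \<equiv> {a. a < N \<and> a < \<sigma> a}"
  shows "(\<Sum>is | length is = N. \<Prod>a\<in>A. q a (is ! a) (is ! \<sigma> a)) = (\<Prod>a\<in>A. \<Sum>k\<in>UNIV. \<Sum>l\<in>UNIV. q a k l)"
proof -
  have \<sigma>A: "\<sigma> a < N" "\<sigma> a \<noteq> a" "\<sigma> (\<sigma> a) = a" if "a < N" for a
    using \<sigma> that by (auto simp: valid_pairing_def)
  define mk :: "(nat \<Rightarrow> 'n \<times> 'n) \<Rightarrow> 'n list" where
    "mk f = map (\<lambda>b. if b < \<sigma> b then fst (f b) else snd (f (\<sigma> b))) [0..<N]" for f
  \<comment> \<open>\<open>un\<close> reads off the pairs that \<open>mk\<close> writes into a list;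
    the restriction to \<open>A\<close> places the result in \<open>PiE\<close>, where functions are
    fixed outside their domain.\<close>
  define un :: "'n list \<Rightarrow> nat \<Rightarrow> 'n \<times> 'n" where
    "un is = restrict (\<lambda>a. (is ! a, is ! \<sigma> a)) A" for "is"
  have "(\<Prod>a\<in>A. \<Sum>k\<in>UNIV. \<Sum>l\<in>UNIV. q a k l) = (\<Prod>a\<in>A. \<Sum>p\<in>UNIV. q a (fst p) (snd p))"
    by (simp add: sum.cartesian_product split_def)
  also have "\<dots> = (\<Sum>f\<in>PiE A (\<lambda>_. UNIV). \<Prod>a\<in>A. q a (fst (f a)) (snd (f a)))"
    by (rule prod_sum_PiE) (auto simp: A_def)
  also have "\<dots> = (\<Sum>is | length is = N. \<Prod>a\<in>A. q a (is ! a) (is ! \<sigma> a))"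
  proof (rule sum.reindex_bij_witness[of _ un mk])
    fix f :: "nat \<Rightarrow> 'n \<times> 'n" assume f: "f \<in> PiE A (\<lambda>_. UNIV)"
    have mk: "mk f ! a = fst (f a)" "mk f ! \<sigma> a = snd (f a)" if "a \<in> A" for a
      using that \<sigma>A[of a] by (auto simp: mk_def A_def)
    show "un (mk f) = f"
    proof
      fix a show "un (mk f) a = f a"
        using f mk[of a] by (cases "a \<in> A") (auto simp: un_def PiE_def extensional_def)
    qed
    show "mk f \<in> {is. length is = N}" by (simp add: mk_def)
    show "(\<Prod>a\<in>A. q a (mk f ! a) (mk f ! \<sigma> a)) = (\<Prod>a\<in>A. q a (fst (f a)) (snd (f a)))"
      by (simp add: mk)
  next
    fix "is" :: "'n list" assume "is \<in> {is. length is = N}"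
    then have l: "length is = N" by simp
    show "un is \<in> PiE A (\<lambda>_. UNIV)" by (simp add: un_def)
    show "mk (un is) = is"
    proof (rule nth_equalityI)
      fix b assume "b < length (mk (un is))"
      then have b: "b < N" by (simp add: mk_def)
      show "mk (un is) ! b = is ! b"
        using b \<sigma>A[of b] by (auto simp: mk_def un_def A_def)
    qed (simp add: mk_def l)
  qed
  finally show ?thesis by simp
qed

text \<open>An involution without fixed points splits the positions into \<open>A\<close> and its
  disjoint image under \<open>\<sigma>\<close>.\<close>

lemma prod_pairing:
  fixes f :: "nat \<Rightarrow> real"
  assumes \<sigma>: "valid_pairing N \<sigma>"
  shows "(\<Prod>b<N. f b) = (\<Prod>a | a < N \<and> a < \<sigma> a. f a * f (\<sigma> a))"
proof -
  define A where "A = {a. a < N \<and> a < \<sigma> a}"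
  have \<sigma>A: "\<sigma> a < N" "\<sigma> a \<noteq> a" "\<sigma> (\<sigma> a) = a" if "a < N" for a
    using \<sigma> that by (auto simp: valid_pairing_def)
  have "{..<N} = A \<union> \<sigma> ` A"
  proof
    show "{..<N} \<subseteq> A \<union> \<sigma> ` A"
    proof
      fix b assume "b \<in> {..<N}"
      then have "b \<in> A \<or> \<sigma> b \<in> A \<and> b = \<sigma> (\<sigma> b)"
        using \<sigma>A[of b] by (auto simp: A_def)
      then show "b \<in> A \<union> \<sigma> ` A" by blast
    qed
    show "A \<union> \<sigma> ` A \<subseteq> {..<N}" using \<sigma>A by (auto simp: A_def)
  qed
  moreover have "\<sigma> a \<notin> A" if "a \<in> A" for a using that \<sigma>A[of a] by (simp add: A_def)
  then have "A \<inter> \<sigma> ` A = {}" by auto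
  moreover have "inj_on \<sigma> A" using \<sigma>A by (intro inj_on_inverseI[of _ \<sigma>]) (auto simp: A_def)
  moreover have "finite A" by (simp add: A_def)
  ultimately have "(\<Prod>b<N. f b) = (\<Prod>a\<in>A. f a) * (\<Prod>a\<in>A. f (\<sigma> a))"
    by (simp add: prod.union_disjoint prod.reindex)
  then show ?thesis by (simp add: A_def prod.distrib)
qed

text \<open>After the pullback is expanded and the sums exchanged, the sum over \<open>is\<close>
  factors over the pairs, and \<open>H\<close> evaluates each factor separately.\<close>

lemma contraction_pull:
  fixes J :: "'n::finite \<Rightarrow> 'n \<Rightarrow> real"
  assumes \<sigma>: "valid_pairing N \<sigma>"
    and H: "\<And>a b. (\<Sum>k\<in>UNIV. \<Sum>l\<in>UNIV. J a k * J b l * H k l) = G a b"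
  shows "(\<Sum>is | length is = N. pull J T is * (\<Prod>a | a < N \<and> a < \<sigma> a. H (is ! a) (is ! \<sigma> a))) =
    (\<Sum>js | length js = N. T js * (\<Prod>a | a < N \<and> a < \<sigma> a. G (js ! a) (js ! \<sigma> a)))"
proof -
  have "(\<Sum>is | length is = N. pull J T is * (\<Prod>a | a < N \<and> a < \<sigma> a. H (is ! a) (is ! \<sigma> a))) =
    (\<Sum>is | length is = N. \<Sum>js | length js = N. T js *
      (\<Prod>a | a < N \<and> a < \<sigma> a. J (js ! a) (is ! a) * J (js ! \<sigma> a) (is ! \<sigma> a) * H (is ! a) (is ! \<sigma> a)))"
    by (intro sum.cong refl)
       (simp add: pull_eq_sum sum_distrib_right sum_distrib_left prod_pairing[OF \<sigma>] prod.distrib mult_ac)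
  also have "\<dots> = (\<Sum>js | length js = N. T js * (\<Sum>is | length is = N.
      (\<Prod>a | a < N \<and> a < \<sigma> a. J (js ! a) (is ! a) * J (js ! \<sigma> a) (is ! \<sigma> a) * H (is ! a) (is ! \<sigma> a))))"
    unfolding sum_distrib_left by (rule sum.swap)
  also have "\<dots> = (\<Sum>js | length js = N. T js * (\<Prod>a | a < N \<and> a < \<sigma> a. G (js ! a) (js ! \<sigma> a)))"
  proof (intro sum.cong refl arg_cong[where f = "(*) _"])
    fix js :: "'n list"
    show "(\<Sum>is | length is = N.
        (\<Prod>a | a < N \<and> a < \<sigma> a. J (js ! a) (is ! a) * J (js ! \<sigma> a) (is ! \<sigma> a) * H (is ! a) (is ! \<sigma> a)))
      = (\<Prod>a | a < N \<and> a < \<sigma> a. G (js ! a) (js ! \<sigma> a))"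
      unfolding sum_lists_pairing[OF \<sigma>, of "\<lambda>a k l. J (js ! a) k * J (js ! \<sigma> a) l * H k l"] H ..
  qed
  finally show ?thesis .
qed

section \<open>Diffeomorphism invariance of the curvature invariants\<close>

context metric_pullback
begin

text \<open>Lowering the first index with \<open>h\<close> supplies a factor \<open>J x l e\<close>,
  which is exactly the contraction that \<open>riem_up_h\<close> transforms.\<close>

lemma riem_h:
  assumes x: "x \<in> U" and "length is = 4"
  shows "riem h x is = pull (J x) (riem g (\<phi> x)) is"
proof -
  obtain a b c d where i: "is = [a, b, c, d]"
    using assms(2) by (auto simp: numeral_eq_Suc length_Suc_conv)
  have "riem h x is = (\<Sum>e\<in>UNIV. \<Sum>k\<in>UNIV. \<Sum>l\<in>UNIV. J x k a * (g (\<phi> x) $ k $ l * (J x l e * riem_up h x e b c d)))"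
    by (simp add: riem_def i h_nth sum_distrib_right sum_distrib_left mult_ac)
  also have "\<dots> = (\<Sum>k\<in>UNIV. J x k a * (\<Sum>l\<in>UNIV. g (\<phi> x) $ k $ l * (\<Sum>e\<in>UNIV. J x l e * riem_up h x e b c d)))"
    unfolding sum_distrib_left by (rule sum_rotate3[symmetric])
  also have "\<dots> = (\<Sum>k\<in>UNIV. J x k a * (\<Sum>l\<in>UNIV. \<Sum>m\<in>UNIV. \<Sum>e\<in>UNIV. \<Sum>f\<in>UNIV.
     J x m b * (J x e c * (J x f d * (g (\<phi> x) $ k $ l * riem_up g (\<phi> x) l m e f)))))"
    unfolding riem_up_h[OF x] by (simp add: sum_distrib_left sum_distrib_right mult_ac)
  also have "\<dots> = (\<Sum>k\<in>UNIV. J x k a * (\<Sum>m\<in>UNIV. \<Sum>e\<in>UNIV. \<Sum>f\<in>UNIV. \<Sum>l\<in>UNIV.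
     J x m b * (J x e c * (J x f d * (g (\<phi> x) $ k $ l * riem_up g (\<phi> x) l m e f)))))"
  \<comment> \<open>The sum over the index \<open>l\<close> contracted with the metric moves
    innermost, where the definition of \<open>riem\<close> has it.\<close>
  proof -
    have rotate: "(\<Sum>l\<in>UNIV. \<Sum>m\<in>UNIV. \<Sum>e\<in>UNIV. \<Sum>f\<in>UNIV. X l m e f) =
      (\<Sum>m\<in>UNIV. \<Sum>e\<in>UNIV. \<Sum>f\<in>UNIV. \<Sum>l\<in>UNIV. X l m e f)" for X :: "'n \<Rightarrow> 'n \<Rightarrow> 'n \<Rightarrow> 'n \<Rightarrow> real"
      by (subst sum.swap) (intro sum.cong refl sum_rotate3[symmetric])
    show ?thesis by (intro sum.cong refl arg_cong[where f = "(*) _"] rotate)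
  qed
  also have "\<dots> = pull (J x) (riem g (\<phi> x)) is"
    by (simp add: i riem_def sum_distrib_left)
  finally show ?thesis .
qed

lemma jet_pull:
  assumes "\<And>ks. jet (\<lambda>_ y. T y ks)"
  shows "jet (\<lambda>_ y. pull (J y) (T y) js)"
  using assms
proof (induction js arbitrary: T)
  case (Cons j js)
  have "jet (\<lambda>_ y. pull (J y) (\<lambda>ks. T y (k # ks)) js)" for k
    by (rule Cons.IH) (rule Cons.prems)
  then show ?case by (simp add: jet_sum jet_mult jet_J)
qed simp

text \<open>The Leibniz rule slot by slot: \<open>dpull\<close> collects the terms in which a
  Jacobian is differentiated.\<close>

lemma pd_pull:
  assumes x: "x \<in> U" and "\<And>ks. jet (\<lambda>_ y. T y ks)"
  shows "pd i (\<lambda>y. pull (J y) (T y) js) x =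
    dpull (J x) (\<lambda>k j. pd i (\<lambda>y. J y k j) x) (T x) js + pull (J x) (\<lambda>ks. pd i (\<lambda>y. T y ks) x) js"
  using assms(2)
proof (induction js arbitrary: T)
  case (Cons j js)
  have "jet (\<lambda>_ y. pull (J y) (\<lambda>ks. T y (k # ks)) js)" for k
    by (rule jet_pull) (rule Cons.prems)
  moreover have "pd i (\<lambda>y. pull (J y) (\<lambda>ks. T y (k # ks)) js) x =
    dpull (J x) (\<lambda>k j. pd i (\<lambda>y. J y k j) x) (\<lambda>ks. T x (k # ks)) js
      + pull (J x) (\<lambda>ks. pd i (\<lambda>y. T y (k # ks)) x) js" for k
    by (rule Cons.IH) (rule Cons.prems)
  ultimately show ?case
    by (simp add: pd_sum_jet[OF _ x] pd_mult_jet[OF _ _ x] jet_mult jet_J sum.distrib distrib_left)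
qed simp

text \<open>The \<open>dpull\<close> terms from differentiating the pullback and from
  \<open>corr_pull\<close> cancel. The relation between \<open>T'\<close> and \<open>T\<close> is
  confined to lists of length \<open>n\<close> because \<open>riem\<close> and \<open>covR\<close>
  are known to transform as tensors only on lists of the right length.\<close>

lemma nabla_h:
  assumes T: "\<And>ks. jet (\<lambda>_ y. T y ks)"
    and T': "\<And>y ks. y \<in> U \<Longrightarrow> length ks = n \<Longrightarrow> T' y ks = pull (J y) (T (\<phi> y)) ks"
    and x: "x \<in> U" and l: "length is = Suc n"
  shows "nabla h T' x is = pull (J x) (nabla g T (\<phi> x)) is"
proof -
  obtain i js where i: "is = i # js" and js: "length js = n" using l by (auto simp: length_Suc_conv)
  have "pd i (\<lambda>y. T' y js) x = pd i (\<lambda>y. pull (J y) (T (\<phi> y)) js) x"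
    by (rule pd_cong_open[OF open_U x]) (simp add: T' js)
  also have "\<dots> = dpull (J x) (\<lambda>k j. pd i (\<lambda>y. J y k j) x) (T (\<phi> x)) js
      + pull (J x) (\<lambda>ks. pd i (\<lambda>y. T (\<phi> y) ks) x) js"
    by (rule pd_pull[OF x]) (rule jet_compose[OF T])
  finally have 1: "pd i (\<lambda>y. T' y js) x = dpull (J x) (\<lambda>k j. pd i (\<lambda>y. J y k j) x) (T (\<phi> x)) js
      + pull (J x) (\<lambda>ks. \<Sum>k\<in>UNIV. J x k i * pd k (\<lambda>y. T y ks) (\<phi> x)) js"
    by (simp add: pd_compose_\<phi>[OF T x])
  have conn: "corr (conn i x) (T (\<phi> x)) =
      (\<lambda>ks. \<Sum>k\<in>UNIV. J x k i * corr (\<lambda>l j. christoffel g (\<phi> x) l k j) (T (\<phi> x)) ks)"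
    unfolding conn_def[abs_def] by (rule ext) (rule corr_sum_connection)
  have "corr (\<lambda>l j. christoffel h x l i j) (T' x) js =
      corr (\<lambda>l j. christoffel h x l i j) (pull (J x) (T (\<phi> x))) js"
    by (rule corr_cong) (simp add: T' x js)
  also have "\<dots> = pull (J x) (corr (conn i x) (T (\<phi> x))) js
      + dpull (J x) (\<lambda>k j. pd i (\<lambda>y. J y k j) x) (T (\<phi> x)) js"
    by (rule corr_pull) (rule J_christoffel_h[OF x])
  finally have 2: "corr (\<lambda>l j. christoffel h x l i j) (T' x) js =
      pull (J x) (\<lambda>ks. \<Sum>k\<in>UNIV. J x k i * corr (\<lambda>l j. christoffel g (\<phi> x) l k j) (T (\<phi> x)) ks) js
      + dpull (J x) (\<lambda>k j. pd i (\<lambda>y. J y k j) x) (T (\<phi> x)) js"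
    by (simp only: conn)
  have "nabla h T' x is = pull (J x) (\<lambda>ks. \<Sum>k\<in>UNIV. J x k i * pd k (\<lambda>y. T y ks) (\<phi> x)) js
      - pull (J x) (\<lambda>ks. \<Sum>k\<in>UNIV. J x k i * corr (\<lambda>l j. christoffel g (\<phi> x) l k j) (T (\<phi> x)) ks) js"
    unfolding i nabla_Cons 1 2 by simp
  also have "\<dots> = pull (J x) (\<lambda>ks. \<Sum>k\<in>UNIV. J x k i * nabla g T (\<phi> x) (k # ks)) js"
    unfolding pull_diff[symmetric]
    by (simp add: nabla_Cons right_diff_distrib sum_subtractf)
  also have "\<dots> = pull (J x) (nabla g T (\<phi> x)) is"
    by (simp add: i pull_sum pull_cmult)
  finally show ?thesis .
qed

lemma covR_h:
  "x \<in> U \<Longrightarrow> length is = m + 4 \<Longrightarrow> covR h m x is = pull (J x) (covR g m (\<phi> x)) is"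
proof (induction m arbitrary: x "is")
  case 0
  then show ?case by (simp add: riem_h)
next
  case (Suc m)
  show ?case unfolding covR.simps
    by (rule nabla_h[OF jet_covR[OF jet_g invertible_g] Suc.IH]) (use Suc.prems in auto)
qed

lemma prodT_h:
  "x \<in> U \<Longrightarrow> length is = total_rank ms \<Longrightarrow> prodT h ms x is = pull (J x) (prodT g ms (\<phi> x)) is"
proof (induction ms arbitrary: "is")
  case Nil
  then show ?case by (simp add: total_rank_def)
next
  case (Cons m ms)
  have "prodT h ms x (drop (m + 4) is) = pull (J x) (prodT g ms (\<phi> x)) (drop (m + 4) is)"
    using Cons.prems by (intro Cons.IH) (auto simp: total_rank_def)
  moreover have "covR h m x (take (m + 4) is) = pull (J x) (covR g m (\<phi> x)) (take (m + 4) is)"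
    using Cons.prems by (intro covR_h) (auto simp: total_rank_def)
  ultimately show ?case
    using Cons.prems pull_append[of "m + 4" "is" "J x" "covR g m (\<phi> x)" "prodT g ms (\<phi> x)"]
    by (simp add: total_rank_def)
qed

lemma full_contraction_h:
  assumes "x \<in> U" "valid_pairing (total_rank ms) \<sigma>"
  shows "full_contraction h ms \<sigma> x = full_contraction g ms \<sigma> (\<phi> x)"
proof -
  have "full_contraction h ms \<sigma> x = (\<Sum>is | length is = total_rank ms. pull (J x) (prodT g ms (\<phi> x)) is *
     (\<Prod>a | a < total_rank ms \<and> a < \<sigma> a. matrix_inv (h x) $ (is ! a) $ (is ! \<sigma> a)))"
    by (simp add: full_contraction_def prodT_h assms(1))
  then show ?thesis
    unfolding full_contraction_def
    by (simp only: contraction_pull[OF assms(2), of "J x" "\<lambda>k l. matrix_inv (h x) $ k $ l",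
          OF J_matrix_inv_h[OF assms(1)]])
qed

lemma curv_inv_h:
  assumes "x \<in> U" "valid_curv_poly P"
  shows "curv_inv P h x = curv_inv P g (\<phi> x)"
proof -
  have "map (\<lambda>(ms, \<sigma>). full_contraction h ms \<sigma> x) mon = map (\<lambda>(ms, \<sigma>). full_contraction g ms \<sigma> (\<phi> x)) mon"
    if "(c, mon) \<in> set P" for c mon
    using assms that by (fastforce simp: valid_curv_poly_def intro!: full_contraction_h)
  then have "map (\<lambda>(c, mon). c * prod_list (map (\<lambda>(ms, \<sigma>). full_contraction h ms \<sigma> x) mon)) P =
      map (\<lambda>(c, mon). c * prod_list (map (\<lambda>(ms, \<sigma>). full_contraction g ms \<sigma> (\<phi> x)) mon)) P"
    by (intro map_cong refl) (simp only: split_paired_all prod.case)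
  then show ?thesis unfolding curv_inv_def by (simp only:)
qed

end

section \<open>Passage to the limit\<close>

theorem theorem2:
  fixes U :: "(real^'n::finite) set"
    and g g0 :: "real^'n \<Rightarrow> real^'n^'n"
    and \<phi> :: "real \<Rightarrow> real^'n \<Rightarrow> real^'n"
    and p :: "real^'n"
  assumes "open U"
    and "pseudo_riem_metric U g"
    and "pseudo_riem_metric U g0"
    and "p \<in> U"
    and "\<And>\<tau>. diffeo_on U (\<phi> \<tau>)"
    and "\<And>\<tau>. \<phi> \<tau> p = p"
    and "\<And>is i j x. x \<in> U \<Longrightarrow>
           ((\<lambda>\<tau>. pds is (\<lambda>y. pullback (\<phi> \<tau>) g y $ i $ j) x)
              \<longlongrightarrow> pds is (\<lambda>y. g0 y $ i $ j) x) at_top"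
    and "valid_curv_poly P"
  shows "curv_inv P g p = curv_inv P g0 p"
proof -
  have mp: "metric_pullback U g (\<phi> \<tau>)" for \<tau>
    by standard (use assms in auto)
  \<comment> \<open>The limit metric joins the family as the member \<open>None\<close>, so one
    \<open>jet_family\<close> contains both the pullbacks and their limit; the filter runs through
    the members \<open>Some \<tau>\<close> only.\<close>
  define G where "G a = (case a of None \<Rightarrow> g0 | Some \<tau> \<Rightarrow> pullback (\<phi> \<tau>) g)" for a
  interpret lim: jet_family U "filtermap Some (at_top :: real filter)" None
    by standard (rule assms(1))
  have smooth_G: "smooth_on U (\<lambda>y. G a y $ i $ j)" for a i j
    using assms(3) metric_pullback.jet_h[OF mp]
    by (cases a) (simp_all add: G_def pseudo_riem_metric_def smooth_on_iff_jet[OF assms(1)])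
  have "lim.jet (\<lambda>a y. G a y $ i $ j)" for i j
    unfolding lim.jet_def lim.jets_def
    using smooth_G assms(7) by (auto simp: smooth_on_def G_def filterlim_filtermap)
  moreover have "invertible (G a x)" if "x \<in> U" for a x
    using assms(3) metric_pullback.invertible_h[OF mp that] that
    by (cases a) (simp_all add: G_def pseudo_riem_metric_def)
  ultimately have "((\<lambda>a. curv_inv P (G a) p) \<longlongrightarrow> curv_inv P (G None) p) (filtermap Some at_top)"
    by (intro lim.jet_tendsto lim.jet_curv_inv assms(4))
  then have "((\<lambda>\<tau>. curv_inv P (pullback (\<phi> \<tau>) g) p) \<longlongrightarrow> curv_inv P g0 p) at_top"
    by (simp add: filterlim_filtermap G_def)
  \<comment> \<open>Invariance together with \<open>\<phi> \<tau> p = p\<close> makes the convergent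
    family constant, so uniqueness of limits finishes the proof.\<close>
  then have "((\<lambda>\<tau>::real. curv_inv P g p) \<longlongrightarrow> curv_inv P g0 p) at_top"
    by (simp add: metric_pullback.curv_inv_h[OF mp assms(4,8)] assms(6))
  then show ?thesis
    by (simp add: tendsto_const_iff)
qed

end
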